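(* Let $\mathbf x=(\mathbf x_1',\dots,\mathbf x_M')'\in\mathbb R^p$ follow a mean-zero multivariate normal distribution with nonsingular covariance matrix, $\mathbf x_l\in\mathbb R^{p_l}$, $p=\sum_lp_l$, and let $y=\sum_{l=1}^M\mathbf x_l'\beta^*_l+\epsilon$, where $\epsilon$ is uncorrelated with the covariates, $E(\epsilon)=0$, $\mathrm{var}(\epsilon)=\sigma_\epsilon^2$. Fix $m\in[M]$, let $\mathbf x_{-m}\in\mathbb R^{p_{-m}}$, $p_{-m}=p-p_m$, be the subvector of $\mathbf x$ excluding $\mathbf x_m$, and set $\sigma^2_{m|-m}=\mathrm{var}(\mathbf x_m'\beta^*_m\mid\mathbf x_{-m})$. Given $n$ i.i.d. observations with $p<n$ and response vector $\mathbf Y\in\mathbb R^n$, let $\hat{\mathbf Y}$ and $\hat{\mathbf Y}_{-m}$ be the predicted response vectors obtained by least squares regression of $y$ on $\mathbf x$ and of $y$ on $\mathbf x_{-m}$, respectively. Let $\sigma_y^2=\mathrm{var}(y)$. Then: (a) $\sigma^2_{m|-m}=E\|\mathbf Y-\hat{\mathbf Y}_{-m}\|_2^2/(n-p_{-m})-\sigma_\epsilon^2$; (b) $\sigma^2_{m|-m}=\sigma_y^2(r^2-r^2_{-m})$, where $r^2=1-E\|\mathbf Y-\hat{\mathbf Y}\|_2^2/\{(n-p)\sigma_y^2\}$ and $r^2_{-m}=1-E\|\mathbf Y-\hat{\mathbf Y}_{-m}\|_2^2/\{(n-p_{-m})\sigma_y^2\}$; (c) if $\mathbf x_m$ and $\mathbf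 x_{-m}$ share common factors, in the sense that $\mathbf x_m=\Lambda_m\mathbf f+\mathbf u_m$ and $\mathbf x_{-m}=\Lambda_{-m}\mathbf f+\mathbf u_{-m}$ with $\mathbf f\in\mathbb R^K$, $\mathrm{var}(\mathbf f)=\mathbf I_K$, and $\mathbf f$ uncorrelated with $(\mathbf u_m',\mathbf u_{-m}')'$, then $$\sigma^2_{m|-m}={\beta^*_m}'\big\{\Lambda_m(\mathbf I_K+\Lambda_{-m}'\Sigma_{u_{-m}}^{-1}\Lambda_{-m})^{-1}\Lambda_m'+\Sigma_{u_m}\big\}\beta^*_m ,$$ where $\Sigma_{u_m}=\mathrm{var}(\mathbf u_m)$ and $\Sigma_{u_{-m}}=\mathrm{var}(\mathbf u_{-m})$, the latter being invertible.
   Context: Least squares regressions are without intercept: with $\mathbf X\in\mathbb R^{n\times p}$ and $\mathbf X_{-m}\in\mathbb R^{n\times p_{-m}}$ the matrices of observations of $\mathbf x$ and $\mathbf x_{-m}$, $\hat{\mathbf Y}=\mathbf X(\mathbf X'\mathbf X)^{-1}\mathbf X'\mathbf Y$ and $\hat{\mathbf Y}_{-m}=\mathbf X_{-m}(\mathbf X_{-m}'\mathbf X_{-m})^{-1}\mathbf X_{-m}'\mathbf Y$. Here $\Lambda_m\in\mathbb R^{p_m\times K}$ and $\Lambda_{-m}\in\mathbb R^{p_{-m}\times K}$ are loading matrices. $[M]=\{1,\dots,M\}$.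
   Formalization: Parts (a), (b) additionally assume E(ε|x)=0 and E(ε²|x)=σ_ε² (uncorrelatedness alone is not enough: ε=x₁z with z an independent sign); part (c) additionally assumes u_m and u_{-m} are uncorrelated (it fails for Λ=0, u=x with correlated blocks). *)

theory Defs
  imports "HOL-Probability.Probability"
begin

section \<open>Blocks of vectors and matrices\<close>

text \<open>
  All vectors built from the \<open>p\<close> covariates live in \<open>real^'p\<close>. The subvector with coordinates
  in \<open>S\<close> (a block \<open>x_l\<close>, or \<open>x_{-m}\<close>) is represented by padding with zeros outside \<open>S\<close>; its
  dimension is \<open>card S\<close>, and \<open>S = {}\<close> is allowed.
\<close>

definition subvec :: "'p set \<Rightarrow> real^'p \<Rightarrow> real^'p" where
  "subvec S v = (\<chi> j. if j \<in> S then v $ j else 0)"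

text \<open>
  \<open>pad S A\<close> is the principal submatrix of \<open>A\<close> on \<open>S\<close>, completed by an identity block outside
  \<open>S\<close>. It is invertible iff the submatrix is, and its inverse is then the inverse of the submatrix
  completed by an identity block. \<open>sub_inv S A\<close> is the inverse of the principal
  submatrix, padded with zeros outside \<open>S \<times> S\<close>.
\<close>

definition pad :: "'p::finite set \<Rightarrow> real^'p^'p \<Rightarrow> real^'p^'p" where
  "pad S A = (\<chi> i j. if i \<in> S \<and> j \<in> S then A $ i $ j else if i = j then 1 else 0)"

definition nonsing_on :: "'p::finite set \<Rightarrow> real^'p^'p \<Rightarrow> bool" where
  "nonsing_on S A \<longleftrightarrow> invertible (pad S A)"

definition sub_inv :: "'p::finite set \<Rightarrow> real^'p^'p \<Rightarrow> real^'p^'p" where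
  "sub_inv S A = (\<chi> i j. if i \<in> S \<and> j \<in> S then matrix_inv (pad S A) $ i $ j else 0)"

lemma sub_inv_right:
  fixes A :: "real^'p^'p"
  assumes "nonsing_on S A" "i \<in> S" "j \<in> S"
  shows "(\<Sum>k\<in>S. A $ i $ k * sub_inv S A $ k $ j) = (if i = j then 1 else 0)"
proof -
  have "pad S A ** matrix_inv (pad S A) = mat 1"
    using assms(1) unfolding nonsing_on_def invertible_def matrix_inv_def
    by (rule exE) (rule someI2, assumption, erule conjunct1)
  then have "(\<Sum>k\<in>UNIV. pad S A $ i $ k * matrix_inv (pad S A) $ k $ j) = (if i = j then 1 else 0)"
    by (simp add: matrix_matrix_mult_def vec_eq_iff mat_def)
  moreover have "(\<Sum>k\<in>UNIV. pad S A $ i $ k * matrix_inv (pad S A) $ k $ j)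
      = (\<Sum>k\<in>S. A $ i $ k * sub_inv S A $ k $ j)"
    using assms(2,3) by (intro sum.mono_neutral_cong_right) (auto simp: pad_def sub_inv_def)
  ultimately show ?thesis by simp
qed

lemma nonsing_onI:
  fixes A B :: "real^'p^'p"
  assumes "\<And>i j. i \<in> S \<Longrightarrow> j \<in> S \<Longrightarrow> (\<Sum>k\<in>S. A $ i $ k * B $ k $ j) = (if i = j then 1 else 0)"
  shows "nonsing_on S A"
proof -
  have "(pad S A ** pad S B) $ i $ j = mat 1 $ i $ j" for i j
  proof (cases "i \<in> S \<and> j \<in> S")
    case True
    have "(pad S A ** pad S B) $ i $ j = (\<Sum>k\<in>S. A $ i $ k * B $ k $ j)"
      unfolding matrix_matrix_mult_def using True
      by (simp, intro sum.mono_neutral_cong_right) (auto simp: pad_def)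
    then show ?thesis using assms True by (simp add: mat_def)
  next
    case False
    have "pad S A $ i $ k * pad S B $ k $ j = (if k = i then mat 1 $ i $ j else 0)" for k
    proof (cases "k = i")
      case True
      then show ?thesis using False by (cases "i \<in> S"; cases "i = j"; simp add: pad_def mat_def)
    next
      case k: False
      then have "pad S A $ i $ k * pad S B $ k $ j = 0"
        using False by (cases "i \<in> S"; cases "k = j"; simp add: pad_def)
      then show ?thesis using k by simp
    qed
    then show ?thesis
      by (simp only: matrix_matrix_mult_def vec_lambda_beta sum.delta[OF finite] UNIV_I if_True)
  qed
  then have AB: "pad S A ** pad S B = mat 1" by (simp add: vec_eq_iff)
  then have BA: "pad S B ** pad S A = mat 1" by (rule matrix_left_right_inverse[THEN iffD1])
  show ?thesis
    unfolding nonsing_on_def invertible_def by (rule exI[of _ "pad S B"], rule conjI[OF AB BA])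
qed

lemma sub_inv_UNIV: "sub_inv UNIV A = matrix_inv A"
  by (simp add: sub_inv_def pad_def vec_eq_iff)

section \<open>Least squares without intercept\<close>

text \<open>
  The fitted values \<open>X\<^sub>S (X\<^sub>S' X\<^sub>S)\<^sup>-\<^sup>1 X\<^sub>S' Y\<close>, where \<open>X\<^sub>S\<close> consists of the columns of \<open>X\<close> with
  index in \<open>S\<close>. Since \<open>sub_inv\<close> vanishes outside \<open>S \<times> S\<close>, only these columns contribute.
\<close>

definition ls_fit :: "'p::finite set \<Rightarrow> real^'p^'n::finite \<Rightarrow> real^'n \<Rightarrow> real^'n" where
  "ls_fit S X Y = X *v (sub_inv S (transpose X ** X) *v (transpose X *v Y))"

lemma ls_fit_UNIV:
  "ls_fit UNIV X Y = (X ** matrix_inv (transpose X ** X) ** transpose X) *v Y"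
  by (simp only: ls_fit_def sub_inv_UNIV matrix_vector_mul_assoc matrix_mul_assoc)

section \<open>Second moments, conditional variance, normal vectors\<close>

definition cov :: "'a measure \<Rightarrow> ('a \<Rightarrow> real) \<Rightarrow> ('a \<Rightarrow> real) \<Rightarrow> real" where
  "cov M X Y = integral\<^sup>L M (\<lambda>\<omega>. (X \<omega> - integral\<^sup>L M X) * (Y \<omega> - integral\<^sup>L M Y))"

definition cov_mat :: "'a measure \<Rightarrow> ('a \<Rightarrow> real^'p) \<Rightarrow> real^'p^'p" where
  "cov_mat M X = (\<chi> i j. cov M (\<lambda>\<omega>. X \<omega> $ i) (\<lambda>\<omega>. X \<omega> $ j))"

definition gen_alg :: "'a measure \<Rightarrow> ('a \<Rightarrow> 'b::topological_space) \<Rightarrow> 'a measure" where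
  "gen_alg M X = vimage_algebra (space M) X borel"

definition cond_var :: "'a measure \<Rightarrow> 'a measure \<Rightarrow> ('a \<Rightarrow> real) \<Rightarrow> 'a \<Rightarrow> real" where
  "cond_var M F Z = real_cond_exp M F (\<lambda>\<omega>. (Z \<omega> - real_cond_exp M F Z \<omega>)\<^sup>2)"

definition std_gauss :: "(real^'p::finite) measure" where
  "std_gauss = density lborel (\<lambda>z. ennreal (\<Prod>i\<in>UNIV. std_normal_density (z $ i)))"

text \<open>
  \<open>X\<close> is distributed as \<open>N(\<mu>, \<Sigma>)\<close> if it has the law of \<open>\<mu> + A z\<close> with \<open>z\<close> standard normal
  and \<open>A A' = \<Sigma>\<close>. A square \<open>A\<close> suffices (take a square root of \<open>\<Sigma>\<close>); singular \<open>\<Sigma>\<close> is allowed.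
\<close>

definition multivariate_normal ::
  "'a measure \<Rightarrow> ('a \<Rightarrow> real^'p::finite) \<Rightarrow> real^'p \<Rightarrow> real^'p^'p \<Rightarrow> bool" where
  "multivariate_normal M X \<mu> \<Sigma> \<longleftrightarrow>
     X \<in> borel_measurable M \<and>
     (\<exists>A :: real^'p^'p. A ** transpose A = \<Sigma> \<and>
        distr M borel X = distr std_gauss borel (\<lambda>z. \<mu> + A *v z))"

end

theory Submission
  imports Defs
begin

text \<open>
  Write \<open>b\<close> for the part of \<open>\<beta>\<close> in block \<open>m\<close> and choose \<open>a\<close> such that \<open>b - a\<close> is supported on \<open>R\<close>
  and \<open>\<Sigma> a\<close> vanishes on \<open>R\<close>. Then \<open>a \<bullet> x\<close> is the residual of the projection of \<open>b \<bullet> x\<close> on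
  \<open>x\<^sub>R\<close>; by normality it is independent of \<open>x\<^sub>R\<close>, so the conditional variance is the constant
  \<open>a \<bullet> \<Sigma> a\<close>. Regressing \<open>y\<close> on \<open>x\<^sub>R\<close> leaves the error \<open>a \<bullet> x + \<epsilon>\<close>, which given \<open>x\<^sub>R\<close> has mean 0
  and variance \<open>a \<bullet> \<Sigma> a + \<sigma>\<^sub>\<epsilon>\<^sup>2\<close>. The residual sum of squares is a quadratic form in the
  errors whose matrix \<open>I - H\<close> depends on \<open>x\<^sub>R\<close> only and has trace \<open>n - card R\<close>, because almost
  surely the rows of \<open>X\<close> span. In the factor model \<open>a\<close> is explicit:
  \<open>a = b - W \<Lambda> (I + \<Lambda>' W \<Lambda>)\<^sup>-\<^sup>1 \<Lambda>' b\<close>, where \<open>W\<close> is the inverse of the block of \<open>\<Sigma>\<^sub>u\<close> on \<open>R\<close>.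
\<close>

section \<open>Coordinate blocks and the residual maker matrix\<close>

text \<open>The obstacle is the inverse of X'X, which is random and unbounded. Only the projection I
  - H enters the argument: its entries lie in [-1, 1] for every nonsingular design, so square
  integrability of the errors suffices once the entries are truncated on the remaining null set.
  Entry (i, j) of the quadratic form is then integrated by redrawing observation i and freezing the
  others. For this reason conditional moments of the errors appear throughout as integrals against
  bounded test functions \<open>h\<close> of the regressors. It is also why \<epsilon> is controlled
  through conditional moments given \<open>x\<close>: I - H is a nonlinear function of the
  regressors, about which zero covariances say nothing. Independence of uncorrelated normal
  variables is obtained from rotation invariance of the standard Gaussian measure, which reduces it
  to independence of coordinates. The regression on all covariates is the instance
  \<open>S = UNIV\<close>, \<open>a = 0\<close> of the same computation, with error \<epsilon>
  alone.\<close>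

lemma subvec_nth [simp]: "subvec S v $ j = (if j \<in> S then v $ j else 0)"
  by (simp add: subvec_def)

lemma subvec_subvec [simp]: "subvec S (subvec S v) = subvec S v"
  by (simp add: vec_eq_iff)

lemma subvec_add: "subvec S (v + w) = subvec S v + subvec S w"
  by (simp add: vec_eq_iff)

lemma subvec_diff: "subvec S (v - w) = subvec S v - subvec S w"
  by (simp add: vec_eq_iff)

lemma subvec_inner_eq_sum: "subvec S v \<bullet> w = (\<Sum>j\<in>S. v $ j * w $ j)"
  by (simp add: inner_vec_def if_distrib[of "\<lambda>a. a * _"] sum.If_cases cong: if_cong)

lemma inner_subvec: "v \<bullet> subvec S w = subvec S v \<bullet> w"
  by (simp add: inner_commute[of v] subvec_inner_eq_sum mult.commute)

lemma subvec_eq_iff: "subvec S v = subvec S w \<longleftrightarrow> (\<forall>j\<in>S. v $ j = w $ j)"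
  by (auto simp: vec_eq_iff)

lemma subvec_inner_eq_0:
  assumes "subvec S w = 0"
  shows "subvec S v \<bullet> w = 0"
  by (metis assms inner_commute inner_subvec inner_zero_left)

lemma subvec_compl_split: "subvec S v + subvec (- S) v = v"
  by (simp add: vec_eq_iff)

lemma matrix_vector_inner_transpose:
  fixes A :: "real^'n^'m"
  shows "(A *v v) \<bullet> w = v \<bullet> (transpose A *v w)"
  by (metis dot_lmul_matrix vector_transpose_matrix transpose_transpose)

section \<open>Kernels and inverses of coordinate blocks\<close>

lemma invertible_if_trivial_kernel:
  fixes A :: "real^'n^'n"
  assumes "\<And>v. A *v v = 0 \<Longrightarrow> v = 0"
  shows "invertible A"
  using assms matrix_left_invertible_ker invertible_left_inverse by blast

lemma pad_mult_vec:
  fixes A :: "real^'p^'p"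
  shows "pad S A *v v = subvec S (A *v subvec S v) + subvec (- S) v"
proof -
  have "(pad S A *v v) $ i = (subvec S (A *v subvec S v) + subvec (- S) v) $ i" for i
  proof (cases "i \<in> S")
    case True
    then show ?thesis
      by (auto simp: matrix_vector_mult_def pad_def intro!: sum.cong)
  next
    case False
    then have "(pad S A *v v) $ i = (\<Sum>k\<in>UNIV. if i = k then v $ k else 0)"
      unfolding matrix_vector_mult_def pad_def vec_lambda_beta by (intro sum.cong) auto
    then show ?thesis using False by simp
  qed
  then show ?thesis by (simp add: vec_eq_iff)
qed

text \<open>A kernel vector w of the padded block is supported on \<open>S\<close>, and there w .
  C'Cw is the squared norm of Cw. This serves twice: with \<open>C\<close> the design matrix, and
  with \<open>C = transpose A\<close> for a covariance matrix A A'.\<close>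

lemma nonsing_on_gram:
  fixes C :: "real^'p^'k"
  assumes "\<And>v. C *v v = 0 \<Longrightarrow> v = 0"
  shows "nonsing_on S (transpose C ** C)"
  unfolding nonsing_on_def
proof (rule invertible_if_trivial_kernel)
  fix v assume 0: "pad S (transpose C ** C) *v v = 0"
  let ?w = "subvec S v"
  have sum0: "subvec S ((transpose C ** C) *v ?w) + subvec (- S) v = 0"
    using 0 by (simp add: pad_mult_vec)
  have v0: "v $ j = 0" if "j \<notin> S" for j
    using sum0 that by (auto simp: vec_eq_iff dest!: spec[of _ j])
  then have vw: "?w = v" by (auto simp: vec_eq_iff)
  have "subvec (- S) v = 0" using v0 by (simp add: vec_eq_iff)
  then have s0: "subvec S ((transpose C ** C) *v ?w) = 0" using sum0 by simp
  have "(C *v ?w) \<bullet> (C *v ?w) = ?w \<bullet> ((transpose C ** C) *v ?w)"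
    by (simp add: matrix_vector_inner_transpose matrix_vector_mul_assoc)
  also have "\<dots> = 0" by (rule subvec_inner_eq_0[OF s0])
  finally show "v = 0" using assms vw by simp
qed

lemma sub_inv_mult_vec:
  fixes A :: "real^'p^'p"
  shows "sub_inv S A *v w = subvec S (matrix_inv (pad S A) *v subvec S w)"
  by (auto simp: vec_eq_iff matrix_vector_mult_def sub_inv_def intro!: sum.cong)

lemma subvec_sub_inv: "subvec S (sub_inv S A *v w) = sub_inv S A *v w"
  by (simp add: sub_inv_mult_vec)

lemma sub_inv_subvec: "sub_inv S A *v subvec S w = sub_inv S A *v w"
  by (simp add: sub_inv_mult_vec)

lemma matrix_inv_invertible:
  fixes A :: "real^'n^'n"
  assumes "invertible A"
  shows "A ** matrix_inv A = mat 1" "matrix_inv A ** A = mat 1"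
proof -
  have "A ** matrix_inv A = mat 1 \<and> matrix_inv A ** A = mat 1"
    using assms unfolding invertible_def matrix_inv_def by (rule someI_ex)
  then show "A ** matrix_inv A = mat 1" "matrix_inv A ** A = mat 1" by auto
qed

text \<open>The rows of \<open>A\<close> outside \<open>S\<close> are not controlled by the block
  inverse, hence the \<open>subvec\<close> on both sides. For the same reason the left inverse
  identity is confined to vectors supported on \<open>S\<close>.\<close>

lemma sub_inv_right_vec:
  fixes A :: "real^'p^'p"
  assumes "nonsing_on S A"
  shows "subvec S (A *v (sub_inv S A *v w)) = subvec S w"
proof -
  have "(A *v (sub_inv S A *v w)) $ i = w $ i" if i: "i \<in> S" for i
  proof -
    have *: "(A ** sub_inv S A) $ i $ j = (if j = i then 1 else 0)" if "j \<in> S" for j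
    proof -
      have "(A ** sub_inv S A) $ i $ j = (\<Sum>k\<in>S. A $ i $ k * sub_inv S A $ k $ j)"
        unfolding matrix_matrix_mult_def vec_lambda_beta
        by (intro sum.mono_neutral_cong_right) (auto simp: sub_inv_def)
      then show ?thesis using sub_inv_right[OF assms i that] by auto
    qed
    have "(A *v (sub_inv S A *v w)) $ i = (A *v (sub_inv S A *v subvec S w)) $ i"
      by (simp add: sub_inv_subvec)
    also have "\<dots> = (\<Sum>j\<in>UNIV. (A ** sub_inv S A) $ i $ j * subvec S w $ j)"
      unfolding matrix_vector_mul_assoc by (simp only: matrix_vector_mult_def vec_lambda_beta)
    also have "\<dots> = (\<Sum>j\<in>UNIV. if j = i then w $ j else 0)"
      using i * by (intro sum.cong) auto
    finally show ?thesis by simp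
  qed
  then show ?thesis by (simp add: subvec_eq_iff)
qed

lemma sub_inv_left_vec:
  fixes A :: "real^'p^'p"
  assumes "nonsing_on S A"
  shows "sub_inv S A *v (A *v subvec S v) = subvec S v"
proof -
  let ?M = "matrix_inv (pad S A)"
  have "?M *v (pad S A *v subvec S v) = subvec S v"
    using matrix_inv_invertible(2) assms unfolding nonsing_on_def
    by (metis matrix_vector_mul_assoc matrix_vector_mul_lid)
  moreover have "pad S A *v subvec S v = subvec S (A *v subvec S v)"
    by (simp add: pad_mult_vec) (simp add: vec_eq_iff)
  ultimately show ?thesis by (simp add: sub_inv_mult_vec)
qed

text \<open>Both W v and W w are supported on \<open>S\<close>, so the second argument of (W v) . w
  may be replaced by A W w. Symmetry of \<open>A\<close> then carries the argument across.\<close>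

lemma transpose_sub_inv:
  fixes A :: "real^'p^'p"
  assumes ns: "nonsing_on S A" and sym: "transpose A = A"
  shows "transpose (sub_inv S A) = sub_inv S A"
proof -
  let ?W = "sub_inv S A"
  have adj: "(?W *v v) \<bullet> w = v \<bullet> (?W *v w)" for v w
  proof -
    have "(?W *v v) \<bullet> w = (?W *v v) \<bullet> (A *v (?W *v w))"
      by (metis inner_subvec subvec_sub_inv sub_inv_right_vec[OF ns])
    also have "\<dots> = (A *v (?W *v v)) \<bullet> (?W *v w)"
      by (simp add: matrix_vector_inner_transpose sym)
    also have "\<dots> = v \<bullet> (?W *v w)"
      by (metis inner_subvec subvec_sub_inv sub_inv_right_vec[OF ns])
    finally show ?thesis .
  qed
  have "v \<bullet> (transpose ?W *v w) = v \<bullet> (?W *v w)" for v w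
    by (simp only: adj matrix_vector_inner_transpose[symmetric])
  then have "transpose ?W *v w = ?W *v w" for w
    using vector_eq_ldot by blast
  then show ?thesis by (simp add: matrix_eq)
qed

section \<open>The hat matrix and the residual maker as projections\<close>

definition hat :: "'p::finite set \<Rightarrow> real^'p^'n::finite \<Rightarrow> real^'n^'n" where
  "hat S X = X ** sub_inv S (transpose X ** X) ** transpose X"

text \<open>For a nonsingular block this is the orthogonal projection onto the complement of the
  span of the columns in \<open>S\<close>. For a singular one it is merely some matrix, since
  \<open>matrix_inv\<close> is then unspecified; such designs form a null set.\<close>

definition resid :: "'p::finite set \<Rightarrow> real^'p^'n::finite \<Rightarrow> real^'n^'n" where
  "resid S X = mat 1 - hat S X"

lemma ls_fit_eq_hat: "ls_fit S X Y = hat S X *v Y"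
  by (simp only: ls_fit_def hat_def matrix_vector_mul_assoc matrix_mul_assoc)

lemma resid_mult_vec: "resid S X *v Y = Y - ls_fit S X Y"
  by (simp add: resid_def ls_fit_eq_hat matrix_vector_mult_diff_rdistrib)

lemma hat_fixes_column_space:
  assumes "nonsing_on S (transpose X ** X)"
  shows "hat S X *v (X *v subvec S c) = X *v subvec S c"
  using sub_inv_left_vec[OF assms, of c]
  by (simp add: hat_def matrix_vector_mul_assoc[symmetric])

lemma hat_idem:
  assumes "nonsing_on S (transpose X ** X)"
  shows "hat S X ** hat S X = hat S X"
proof -
  have "hat S X *v (hat S X *v v) = hat S X *v v" for v
  proof -
    have "hat S X *v v = X *v subvec S (sub_inv S (transpose X ** X) *v (transpose X *v v))"
      by (simp add: hat_def matrix_vector_mul_assoc[symmetric] subvec_sub_inv)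
    then show ?thesis using hat_fixes_column_space[OF assms] by simp
  qed
  then show ?thesis by (simp add: matrix_eq matrix_vector_mul_assoc[symmetric])
qed

lemma transpose_hat:
  assumes "nonsing_on S (transpose X ** X)"
  shows "transpose (hat S X) = hat S X"
  using transpose_sub_inv[OF assms]
  by (simp add: hat_def matrix_transpose_mul matrix_mul_assoc)

lemma trace_hat:
  assumes "nonsing_on S (transpose X ** X)"
  shows "trace (hat S X) = real (card S)"
proof -
  let ?A = "transpose X ** X" and ?W = "sub_inv S (transpose X ** X)"
  \<comment> \<open>Only the diagonal is claimed. Columns of \<open>?W ** ?A\<close> with index
    outside \<open>S\<close> can have nonzero entries in the rows of \<open>S\<close>, but these do
    not meet the trace.\<close>
  have d: "(?W ** ?A) $ i $ i = (if i \<in> S then 1 else 0)" for i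
  proof -
    have "(?W ** ?A) $ i $ i = (?W *v (?A *v axis i 1)) $ i"
      unfolding matrix_vector_mul_assoc by (simp add: matrix_vector_mult_basis column_def)
    moreover have "subvec S (axis i 1) = (axis i 1 :: real^'a)" if "i \<in> S"
      using that by (auto simp: vec_eq_iff axis_def)
    moreover have "(?W *v w) $ i = 0" if "i \<notin> S" for w
      using that by (subst subvec_sub_inv[symmetric]) (simp del: subvec_subvec)
    moreover have "(axis i 1 :: real^'a) $ i = 1" by simp
    ultimately show ?thesis
      using sub_inv_left_vec[OF assms, of "axis i 1"] by (cases "i \<in> S") metis+
  qed
  have "trace (hat S X) = trace (transpose X ** (X ** ?W))"
    unfolding hat_def by (rule trace_mul_sym)
  also have "\<dots> = trace (?A ** ?W)" by (simp add: matrix_mul_assoc)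
  also have "\<dots> = trace (?W ** ?A)" by (rule trace_mul_sym)
  also have "\<dots> = real (card S)"
    by (simp add: trace_def d sum.If_cases)
  finally show ?thesis .
qed

lemma resid_idem:
  assumes "nonsing_on S (transpose X ** X)"
  shows "resid S X ** resid S X = resid S X"
proof -
  have "resid S X *v (resid S X *v v) = resid S X *v v" for v
  proof -
    have "hat S X *v (hat S X *v v) = hat S X *v v"
      using hat_idem[OF assms] by (simp only: matrix_vector_mul_assoc)
    then show ?thesis
      by (simp add: resid_def matrix_vector_mult_diff_rdistrib matrix_vector_mult_diff_distrib)
  qed
  then show ?thesis by (simp add: matrix_eq matrix_vector_mul_assoc[symmetric])
qed

lemma transpose_resid:
  assumes "nonsing_on S (transpose X ** X)"
  shows "transpose (resid S X) = resid S X"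
  using transpose_hat[OF assms]
  by (simp add: resid_def transpose_def vec_eq_iff mat_def)

lemma trace_resid:
  fixes X :: "real^'p^'n"
  assumes "nonsing_on S (transpose X ** X)"
  shows "trace (resid S X) = real CARD('n) - real (card S)"
  using trace_hat[OF assms] by (simp add: resid_def trace_sub trace_I)

text \<open>For a symmetric idempotent G the diagonal entry is G_ii = sum over k of G_ik^2. Hence
  G_ii^2 <= G_ii, so G_ii <= 1, and every G_ij^2 is at most G_ii. This bound makes the quadratic
  form in the errors integrable.\<close>

lemma resid_entry_le_1:
  fixes X :: "real^'p^'n"
  assumes "nonsing_on S (transpose X ** X)"
  shows "\<bar>resid S X $ i $ j\<bar> \<le> 1"
proof -
  let ?G = "resid S X"
  have "?G $ i $ i = (\<Sum>k\<in>UNIV. (?G $ i $ k)\<^sup>2)"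
  proof -
    have "?G $ i $ i = (?G ** transpose ?G) $ i $ i"
      using resid_idem[OF assms] transpose_resid[OF assms] by simp
    then show ?thesis by (simp add: matrix_matrix_mult_def transpose_def power2_eq_square)
  qed
  then have le: "(?G $ i $ k)\<^sup>2 \<le> ?G $ i $ i" for k
    using member_le_sum[of k UNIV "\<lambda>k. (?G $ i $ k)\<^sup>2"] by simp
  have "(?G $ i $ i)\<^sup>2 \<le> ?G $ i $ i" by (rule le)
  then have "?G $ i $ i \<le> 1"
    using mult_strict_right_mono[of 1 "?G $ i $ i" "?G $ i $ i"]
    by (fastforce simp: power2_eq_square not_less[symmetric])
  then have "(?G $ i $ j)\<^sup>2 \<le> 1" using le[of j] by simp
  then show ?thesis by (simp add: abs_square_le_1)
qed

text \<open>The residual maker annihilates X c whenever \<open>c\<close> is supported on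
  \<open>S\<close>, so \<open>c\<close> is free here. Choosing the population projection coefficient
  later turns Y - X c into the vector of projection errors. Idempotence and symmetry reduce the
  squared norm of G w to w . G w.\<close>

lemma rss_quadratic_form:
  fixes X :: "real^'p^'n"
  assumes ns: "nonsing_on S (transpose X ** X)" and c: "subvec S c = c"
  shows "(norm (Y - ls_fit S X Y))\<^sup>2
    = (\<Sum>i\<in>UNIV. \<Sum>j\<in>UNIV. resid S X $ i $ j * (Y - X *v c) $ i * (Y - X *v c) $ j)"
proof -
  let ?G = "resid S X" and ?W = "Y - X *v c"
  have "?G *v (X *v c) = 0"
    using hat_fixes_column_space[OF ns, of c] by (simp add: resid_mult_vec ls_fit_eq_hat c)
  then have "Y - ls_fit S X Y = ?G *v ?W"
    by (simp add: resid_mult_vec[symmetric] matrix_vector_mult_diff_distrib)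
  then have "(norm (Y - ls_fit S X Y))\<^sup>2 = (?G *v ?W) \<bullet> (?G *v ?W)"
    by (simp add: power2_norm_eq_inner)
  also have "\<dots> = ?W \<bullet> (?G *v ?W)"
    using resid_idem[OF ns] transpose_resid[OF ns]
    by (simp add: matrix_vector_inner_transpose matrix_vector_mul_assoc)
  finally show ?thesis
    by (simp add: inner_vec_def matrix_vector_mult_def sum_distrib_left mult_ac)
qed

text \<open>This allows a single row of the design to be replaced by its truncation to
  \<open>S\<close>, so that, with the other rows frozen, the residual maker becomes a function of
  the regressors of one observation.\<close>

lemma hat_cong_subvec:
  fixes X X' :: "real^'p^'n"
  assumes "\<And>i. subvec S (X $ i) = subvec S (X' $ i)"
  shows "hat S X = hat S X'"
proof -
  have e: "X $ i $ j = X' $ i $ j" if "j \<in> S" for i j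
    using assms[of i] that by (auto simp: subvec_eq_iff)
  have "pad S (transpose X ** X) = pad S (transpose X' ** X')"
    by (auto simp: pad_def vec_eq_iff matrix_matrix_mult_def transpose_def e)
  then have W: "sub_inv S (transpose X ** X) = sub_inv S (transpose X' ** X')"
    unfolding sub_inv_def by (simp only:)
  let ?W = "sub_inv S (transpose X' ** X')"
  have XW: "Z *v (?W *v w) = Z' *v (?W *v w)" if "\<And>i j. j \<in> S \<Longrightarrow> Z $ i $ j = Z' $ i $ j"
    for Z Z' :: "real^'p^'n" and w
  proof -
    have "Z *v subvec S t = Z' *v subvec S t" for t
      using that by (auto simp: vec_eq_iff matrix_vector_mult_def intro!: sum.cong)
    then show ?thesis by (metis subvec_sub_inv)
  qed
  have "subvec S (transpose X *v w) = subvec S (transpose X' *v w)" for w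
    by (simp add: subvec_eq_iff matrix_vector_mult_def transpose_def e)
  then have "?W *v (transpose X *v w) = ?W *v (transpose X' *v w)" for w
    by (metis sub_inv_subvec)
  then show ?thesis
    using XW[of X X'] e by (simp add: hat_def matrix_eq matrix_vector_mul_assoc[symmetric] W)
qed

lemma resid_cong_subvec:
  assumes "\<And>i. subvec S (X $ i) = subvec S (X' $ i)"
  shows "resid S X = resid S X'"
  using hat_cong_subvec[of S X X'] assms by (simp add: resid_def)

section \<open>Measurability of matrix inverses and of the residual sum of squares\<close>

lemma matrix_inv_eq_cramer:
  fixes A :: "real^'n^'n"
  shows "matrix_inv A $ i $ j = (if det A = 0 then (SOME A'::real^'n^'n. False) $ i $ j
     else det (\<chi> r c. if c = i then axis j 1 $ r else A $ r $ c) / det A)"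
proof (cases "det A = 0")
  case True
  \<comment> \<open>For every singular matrix the defining predicate of \<open>matrix_inv\<close> is
    the same empty one, so the unspecified choice is a constant that does not vary with
    \<open>A\<close>. Without this the inverse could not be shown measurable on the set of singular
    matrices.\<close>
  then have "(\<lambda>A'. A ** A' = mat 1 \<and> A' ** A = mat 1) = (\<lambda>A'. False)"
    using invertible_det_nz[of A] unfolding invertible_def by blast
  then show ?thesis using True by (simp add: matrix_inv_def)
next
  case False
  then have "A *v (matrix_inv A *v axis j 1) = axis j 1"
    using matrix_inv_invertible(1)[of A] invertible_det_nz[of A]
    by (simp add: matrix_vector_mul_assoc)
  then have "matrix_inv A *v axis j 1
      = (\<chi> k. det (\<chi> r c. if c = k then axis j 1 $ r else A $ r $ c) / det A)"
    using cramer[OF False] by blast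
  then have "(matrix_inv A *v axis j 1) $ i
      = det (\<chi> r c. if c = i then axis j 1 $ r else A $ r $ c) / det A" by simp
  then show ?thesis using False
    by (simp add: matrix_vector_mult_basis column_def)
qed

lemma borel_measurable_vecI:
  fixes F :: "'a \<Rightarrow> real^'n"
  assumes "\<And>i. (\<lambda>\<omega>. F \<omega> $ i) \<in> borel_measurable M"
  shows "F \<in> borel_measurable M"
  using assms by (subst borel_measurable_euclidean_space) (auto simp: Basis_vec_def inner_axis)

lemma borel_measurable_subvec [measurable]: "subvec S \<in> borel_measurable borel"
  by (rule borel_measurable_vecI) (simp add: subvec_def)

lemma borel_measurable_det:
  fixes F :: "'a \<Rightarrow> real^'n^'n"
  assumes "\<And>i j. (\<lambda>\<omega>. F \<omega> $ i $ j) \<in> borel_measurable M"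
  shows "(\<lambda>\<omega>. det (F \<omega>)) \<in> borel_measurable M"
  unfolding det_def using assms
  by (intro borel_measurable_sum borel_measurable_times borel_measurable_const borel_measurable_prod)

lemma borel_measurable_matrix_inv:
  fixes F :: "'a \<Rightarrow> real^'n^'n"
  assumes F: "\<And>i j. (\<lambda>\<omega>. F \<omega> $ i $ j) \<in> borel_measurable M"
  shows "(\<lambda>\<omega>. matrix_inv (F \<omega>) $ i $ j) \<in> borel_measurable M"
proof -
  have [measurable]: "(\<lambda>\<omega>. det (F \<omega>)) \<in> borel_measurable M"
    by (rule borel_measurable_det) (rule F)
  have [measurable]: "(\<lambda>\<omega>. det (\<chi> r c. if c = i then axis j 1 $ r else F \<omega> $ r $ c)) \<in> borel_measurable M"
    using F by (intro borel_measurable_det) simp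
  show ?thesis unfolding matrix_inv_eq_cramer by measurable
qed

lemma matrix_matrix_mult_nth: "(A ** B) $ i $ j = (\<Sum>k\<in>UNIV. A $ i $ k * B $ k $ j)"
  by (simp add: matrix_matrix_mult_def)

lemma borel_measurable_resid:
  fixes F :: "'a \<Rightarrow> real^'p^'n"
  assumes F [measurable]: "\<And>i j. (\<lambda>\<omega>. F \<omega> $ i $ j) \<in> borel_measurable M"
  shows "(\<lambda>\<omega>. resid S (F \<omega>) $ i $ j) \<in> borel_measurable M"
proof -
  have [measurable]: "(\<lambda>\<omega>. (transpose (F \<omega>) ** F \<omega>) $ i $ j) \<in> borel_measurable M" for i j
    by (simp add: matrix_matrix_mult_def transpose_def)
  have [measurable]: "(\<lambda>\<omega>. pad S (transpose (F \<omega>) ** F \<omega>) $ i $ j) \<in> borel_measurable M" for i j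
    by (simp add: pad_def)
  have [measurable]: "(\<lambda>\<omega>. sub_inv S (transpose (F \<omega>) ** F \<omega>) $ i $ j) \<in> borel_measurable M" for i j
    unfolding sub_inv_def vec_lambda_beta
    using borel_measurable_matrix_inv[of "\<lambda>\<omega>. pad S (transpose (F \<omega>) ** F \<omega>)" M i j]
    by (cases "i \<in> S"; cases "j \<in> S") simp_all
  have [measurable]: "(\<lambda>\<omega>. hat S (F \<omega>) $ i $ j) \<in> borel_measurable M" for i j
  proof -
    have "hat S (F \<omega>) $ i $ j = (\<Sum>l\<in>UNIV. (\<Sum>k\<in>UNIV. F \<omega> $ i $ k
        * sub_inv S (transpose (F \<omega>) ** F \<omega>) $ k $ l) * F \<omega> $ j $ l)" for \<omega>
      unfolding hat_def
      by (simp only: matrix_matrix_mult_nth[of "_ ** _"] matrix_matrix_mult_nth[of "F \<omega>"])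
        (simp only: transpose_def vec_lambda_beta)
    then show ?thesis by simp
  qed
  show ?thesis by (simp add: resid_def)
qed

lemma borel_measurable_rss:
  fixes X :: "'a \<Rightarrow> real^'p^'n" and Y :: "'a \<Rightarrow> real^'n"
  assumes X: "\<And>i j. (\<lambda>\<omega>. X \<omega> $ i $ j) \<in> borel_measurable M"
    and Y [measurable]: "\<And>i. (\<lambda>\<omega>. Y \<omega> $ i) \<in> borel_measurable M"
  shows "(\<lambda>\<omega>. (norm (Y \<omega> - ls_fit S (X \<omega>) (Y \<omega>)))\<^sup>2) \<in> borel_measurable M"
proof -
  have [measurable]: "(\<lambda>\<omega>. resid S (X \<omega>) $ i $ j) \<in> borel_measurable M" for i j
    by (rule borel_measurable_resid) (rule X)
  have "(\<lambda>\<omega>. (norm (Y \<omega> - ls_fit S (X \<omega>) (Y \<omega>)))\<^sup>2)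
      = (\<lambda>\<omega>. \<Sum>i\<in>UNIV. (\<Sum>j\<in>UNIV. resid S (X \<omega>) $ i $ j * Y \<omega> $ j)\<^sup>2)"
    by (simp only: power2_norm_eq_inner resid_mult_vec[symmetric])
      (simp add: inner_vec_def matrix_vector_mult_def power2_eq_square)
  then show ?thesis by simp
qed

section \<open>Independent observations and the expected residual sum of squares\<close>

lemma borel_measurable_vec_nth [measurable (raw)]:
  fixes F :: "'a \<Rightarrow> 'b::euclidean_space ^'n"
  assumes "F \<in> borel_measurable M"
  shows "(\<lambda>\<omega>. F \<omega> $ i) \<in> borel_measurable M"
  using assms by (rule borel_measurable_continuous_on[OF continuous_on_component[OF continuous_on_id]])

section \<open>Resampling one coordinate of a product measure\<close>

lemma measurable_fun_upd_PiM:
  fixes M :: "'i::finite \<Rightarrow> 'a measure"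
  shows "(\<lambda>(\<omega>, t). fun_upd \<omega> k t) \<in> PiM UNIV M \<Otimes>\<^sub>M M k \<rightarrow>\<^sub>M PiM UNIV M"
  unfolding case_prod_beta by (rule measurable_fun_upd[where J=UNIV]) auto

text \<open>It suffices to test boxes. The preimage of a box relaxes side \<open>k\<close> to the
  whole space, since the old value there is discarded, and requires the new draw to lie in
  \<open>A k\<close>; the relaxed side contributes the factor 1.\<close>

lemma distr_fun_upd_PiM:
  fixes M :: "'i::finite \<Rightarrow> 'a measure"
  assumes "\<And>i. prob_space (M i)"
  shows "distr (PiM UNIV M \<Otimes>\<^sub>M M k) (PiM UNIV M) (\<lambda>(\<omega>, t). fun_upd \<omega> k t) = PiM UNIV M"
proof -
  interpret product_prob_space M UNIV
    using assms by (simp add: product_prob_space_def product_prob_space_axioms_def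
        product_sigma_finite_def prob_space_imp_sigma_finite)
  interpret P: prob_space "PiM UNIV M" by (rule prob_space_PiM) (rule assms)
  interpret K: prob_space "M k" by (rule assms)
  note meas = measurable_fun_upd_PiM[of k M]
  show ?thesis
  proof (rule PiM_eqI)
    fix A :: "'i \<Rightarrow> 'a set"
    assume A: "\<And>i. i \<in> UNIV \<Longrightarrow> A i \<in> sets (M i)"
    have sub: "A i \<subseteq> space (M i)" for i using A[of i] sets.sets_into_space by auto
    let ?B = "fun_upd A k (space (M k))"
    have "(\<lambda>(\<omega>, t). fun_upd \<omega> k t) -` (Pi\<^sub>E UNIV A) \<inter> space (PiM UNIV M \<Otimes>\<^sub>M M k)
        = Pi\<^sub>E UNIV ?B \<times> A k"
      using sub unfolding space_pair_measure space_PiM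
      by (auto simp: PiE_iff split: if_splits) blast+
    then have "emeasure (distr (PiM UNIV M \<Otimes>\<^sub>M M k) (PiM UNIV M) (\<lambda>(\<omega>, t). fun_upd \<omega> k t)) (Pi\<^sub>E UNIV A)
        = emeasure (PiM UNIV M \<Otimes>\<^sub>M M k) (Pi\<^sub>E UNIV ?B \<times> A k)"
      using A by (subst emeasure_distr[OF meas]) (auto intro!: sets_PiM_I_finite)
    also have "\<dots> = emeasure (PiM UNIV M) (Pi\<^sub>E UNIV ?B) * emeasure (M k) (A k)"
      using A by (intro sigma_finite_measure.emeasure_pair_measure_Times sets_PiM_I_finite)
        (auto simp: prob_space_imp_sigma_finite[OF assms])
    also have "emeasure (PiM UNIV M) (Pi\<^sub>E UNIV ?B) = (\<Prod>i\<in>UNIV. emeasure (M i) (?B i))"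
      using A by (intro emeasure_PiM) auto
    also have "\<dots> = (\<Prod>i\<in>UNIV - {k}. emeasure (M i) (A i))"
      by (subst prod.remove[of _ k]) (auto simp: prob_space.emeasure_space_1[OF assms] intro!: prod.cong)
    also have "\<dots> * emeasure (M k) (A k) = (\<Prod>i\<in>UNIV. emeasure (M i) (A i))"
      by (subst (2) prod.remove[of _ k]) (auto simp: mult.commute)
    finally show "emeasure (distr (PiM UNIV M \<Otimes>\<^sub>M M k) (PiM UNIV M) (\<lambda>(\<omega>, t). fun_upd \<omega> k t))
        (Pi\<^sub>E UNIV A) = (\<Prod>i\<in>UNIV. emeasure (M i) (A i))" .
  qed simp_all
qed

text \<open>A form of Fubini that keeps the index type intact: the outer integral still runs over
  all coordinates, but the old value of coordinate \<open>k\<close> is overwritten before it is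
  used.\<close>

lemma integral_PiM_resample:
  fixes M :: "'i::finite \<Rightarrow> 'a measure" and \<Phi> :: "('i \<Rightarrow> 'a) \<Rightarrow> real"
  assumes M: "\<And>i. prob_space (M i)" and int: "integrable (PiM UNIV M) \<Phi>"
  shows "(\<integral>\<omega>. \<Phi> \<omega> \<partial>PiM UNIV M) = (\<integral>\<omega>. (\<integral>t. \<Phi> (fun_upd \<omega> k t) \<partial>M k) \<partial>PiM UNIV M)"
proof -
  interpret P: prob_space "PiM UNIV M" by (rule prob_space_PiM) (rule M)
  interpret K: prob_space "M k" by (rule M)
  interpret pair_sigma_finite "PiM UNIV M" "M k" ..
  let ?U = "\<lambda>(\<omega>, t). fun_upd \<omega> k t"
  note meas = measurable_fun_upd_PiM[of k M]
  have [measurable]: "\<Phi> \<in> borel_measurable (PiM UNIV M)" using int by auto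
  have "integrable (distr (PiM UNIV M \<Otimes>\<^sub>M M k) (PiM UNIV M) ?U) \<Phi>"
    using int by (simp only: distr_fun_upd_PiM[of M k, OF M])
  then have "integrable (PiM UNIV M \<Otimes>\<^sub>M M k) (\<lambda>z. \<Phi> (?U z))"
    by (simp add: integrable_distr_eq[OF meas])
  then have i: "integrable (PiM UNIV M \<Otimes>\<^sub>M M k) (\<lambda>(\<omega>, t). \<Phi> (fun_upd \<omega> k t))"
    by (simp only: split_def)
  have "(\<integral>\<omega>. \<Phi> \<omega> \<partial>PiM UNIV M) = (\<integral>z. \<Phi> (?U z) \<partial>(PiM UNIV M \<Otimes>\<^sub>M M k))"
    by (subst distr_fun_upd_PiM[of M k, OF M, symmetric], rule integral_distr[OF meas]) measurable
  also have "\<dots> = (\<integral>\<omega>. (\<integral>t. \<Phi> (fun_upd \<omega> k t) \<partial>M k) \<partial>PiM UNIV M)"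
    using integral_fst'[OF i] by (simp add: split_def del: fun_upd_apply)
  finally show ?thesis .
qed

lemma AE_PiM_resample:
  fixes M :: "'i::finite \<Rightarrow> 'a measure"
  assumes M: "\<And>i. prob_space (M i)"
    and Q: "{\<omega> \<in> space (PiM UNIV M). Q \<omega>} \<in> sets (PiM UNIV M)"
    and AE: "AE \<omega> in PiM UNIV M. AE t in M k. Q (fun_upd \<omega> k t)"
  shows "AE \<omega> in PiM UNIV M. Q \<omega>"
proof -
  interpret P: prob_space "PiM UNIV M" by (rule prob_space_PiM) (rule M)
  interpret K: prob_space "M k" by (rule M)
  interpret pair_sigma_finite "PiM UNIV M" "M k" ..
  note meas = measurable_fun_upd_PiM[of k M]
  have "{z \<in> space (PiM UNIV M \<Otimes>\<^sub>M M k). Q (case z of (\<omega>, t) \<Rightarrow> fun_upd \<omega> k t)}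
      = (\<lambda>(\<omega>, t). fun_upd \<omega> k t) -` {\<omega> \<in> space (PiM UNIV M). Q \<omega>} \<inter> space (PiM UNIV M \<Otimes>\<^sub>M M k)"
    using measurable_space[OF meas] by auto
  then have "{z \<in> space (PiM UNIV M \<Otimes>\<^sub>M M k). Q (case z of (\<omega>, t) \<Rightarrow> fun_upd \<omega> k t)}
      \<in> sets (PiM UNIV M \<Otimes>\<^sub>M M k)"
    using measurable_sets[OF meas Q] by simp
  then have "AE z in PiM UNIV M \<Otimes>\<^sub>M M k. Q (case z of (\<omega>, t) \<Rightarrow> fun_upd \<omega> k t)"
    by (rule AE_pair_measure) (use AE in simp)
  then have "AE \<omega> in distr (PiM UNIV M \<Otimes>\<^sub>M M k) (PiM UNIV M) (\<lambda>(\<omega>, t). fun_upd \<omega> k t). Q \<omega>"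
    by (subst AE_distr_iff[OF meas Q])
  then show ?thesis by (simp only: distr_fun_upd_PiM[of M k, OF M])
qed

section \<open>Almost sure full rank of the design\<close>

lemma det_row_inner:
  fixes B :: "'p::finite \<Rightarrow> real^'p"
  shows "det (\<chi> r. if r = i then v else B r) = (\<chi> j. det (\<chi> r. if r = i then axis j 1 else B r)) \<bullet> v"
proof -
  have "det (\<chi> r. if r = i then v else B r)
      = det (\<chi> r. if r = i then \<Sum>j\<in>UNIV. v $ j *s axis j 1 else B r)"
    by (simp only: basis_expansion)
  also have "\<dots> = (\<Sum>j\<in>UNIV. v $ j * det (\<chi> r. if r = i then axis j 1 else B r))"
    by (subst det_linear_row_sum) (simp_all add: det_row_mul)
  finally show ?thesis by (simp add: inner_vec_def mult.commute)
qed

text \<open>Rows of the identity matrix are replaced by random rows one at a time. With the other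
  rows frozen, the determinant is a linear form in the new row, with cofactor vector c. The
  component of c at \<open>i\<close> is the determinant of the previous stage, nonzero almost surely
  by induction, so c is nonzero and \<open>nondeg\<close> applies. Injectivity of \<open>g\<close>
  guarantees that redrawing observation \<open>g i\<close> leaves the other rows alone.\<close>

lemma AE_PiM_rows_independent:
  fixes L :: "'b measure" and \<xi> :: "'b \<Rightarrow> real^'p" and g :: "'p \<Rightarrow> 'n::finite" and I :: "'p set"
  assumes L: "prob_space L" and \<xi> [measurable]: "\<xi> \<in> borel_measurable L" and g: "inj g"
    and nondeg: "\<And>a. a \<noteq> 0 \<Longrightarrow> AE t in L. a \<bullet> \<xi> t \<noteq> 0"
  shows "AE \<omega> in PiM UNIV (\<lambda>_::'n. L). det (\<chi> r. if r \<in> I then \<xi> (\<omega> (g r)) else axis r 1) \<noteq> 0"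
proof -
  let ?D = "\<lambda>I \<omega>. det (\<chi> r. if r \<in> I then \<xi> (\<omega> (g r)) else axis r 1)"
  let ?P = "PiM UNIV (\<lambda>_::'n. L)"
  have [measurable]: "?D I \<in> borel_measurable ?P" for I
    by (rule borel_measurable_det) (auto intro!: borel_measurable_vec_nth split: if_splits)
  have "finite I" by simp
  then show ?thesis
  proof (induction I rule: finite_induct)
    case empty
    have "(\<chi> r. axis r 1) = (mat 1 :: real^'p^'p)"
      by (simp add: mat_def vec_eq_iff axis_def)
    then show ?case by simp
  next
    case (insert i I)
    show ?case
    proof (rule AE_PiM_resample[where k = "g i"])
      show "{\<omega> \<in> space ?P. ?D (insert i I) \<omega> \<noteq> 0} \<in> sets ?P" by measurable
      show "AE \<omega> in ?P. AE t in L. ?D (insert i I) (fun_upd \<omega> (g i) t) \<noteq> 0"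
        using insert.IH
      proof (rule AE_mp[OF _ AE_I2[OF impI]])
        fix \<omega> assume nz: "?D I \<omega> \<noteq> 0"
        let ?B = "\<lambda>r. if r \<in> I then \<xi> (\<omega> (g r)) else axis r 1"
        let ?c = "\<chi> j. det (\<chi> r. if r = i then axis j 1 else ?B r)"
        have "(\<lambda>r. if r = i then axis i 1 else ?B r) = ?B" using insert.hyps by auto
        then have "?c $ i = ?D I \<omega>" by simp
        then have "?c \<noteq> 0" using nz by (metis zero_index)
        then have "AE t in L. ?c \<bullet> \<xi> t \<noteq> 0" by (rule nondeg)
        moreover have "?D (insert i I) (fun_upd \<omega> (g i) t) = ?c \<bullet> \<xi> t" for t
        proof -
          have "(\<lambda>r. if r \<in> insert i I then \<xi> ((fun_upd \<omega> (g i) t) (g r)) else axis r 1)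
              = (\<lambda>r. if r = i then \<xi> t else ?B r)"
            using inj_eq[OF g] insert.hyps by auto
          then show ?thesis using det_row_inner[of i "\<xi> t" ?B] by simp
        qed
        ultimately show "AE t in L. ?D (insert i I) (fun_upd \<omega> (g i) t) \<noteq> 0" by simp
      qed
    qed (rule L)
  qed
qed

lemma AE_PiM_gram_nonsing:
  fixes L :: "'b measure" and \<xi> :: "'b \<Rightarrow> real^'p" and S :: "'p set"
  assumes L: "prob_space L" and \<xi>: "\<xi> \<in> borel_measurable L"
    and nondeg: "\<And>a. a \<noteq> 0 \<Longrightarrow> AE t in L. a \<bullet> \<xi> t \<noteq> 0"
    and card: "CARD('p) \<le> CARD('n::finite)"
  shows "AE \<omega> in PiM UNIV (\<lambda>_::'n. L).
    nonsing_on S (transpose (\<chi> i. \<xi> (\<omega> i)) ** (\<chi> i. \<xi> (\<omega> i)))"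
proof -
  \<comment> \<open>An injection selects as many observations as there are covariates; if the
    selected rows form an invertible square matrix, the whole design has trivial kernel.\<close>
  obtain g :: "'p \<Rightarrow> 'n" where g: "inj g"
    using card card_le_inj[of "UNIV :: 'p set" "UNIV :: 'n set"] by auto
  show ?thesis
    using AE_PiM_rows_independent[OF L \<xi> g nondeg, of UNIV]
  proof (rule AE_mp[OF _ AE_I2[OF impI]])
    fix \<omega> :: "'n \<Rightarrow> 'b"
    assume "det (\<chi> r. if r \<in> UNIV then \<xi> (\<omega> (g r)) else axis r 1) \<noteq> 0"
    then have inv: "invertible (\<chi> r. \<xi> (\<omega> (g r)))" by (simp add: invertible_det_nz)
    show "nonsing_on S (transpose (\<chi> i. \<xi> (\<omega> i)) ** (\<chi> i. \<xi> (\<omega> i)))"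
    proof (rule nonsing_on_gram)
      fix v assume "(\<chi> i. \<xi> (\<omega> i)) *v v = 0"
      then have "\<xi> (\<omega> i) \<bullet> v = 0" for i
        by (simp add: matrix_vector_mul_component vec_eq_iff)
      then have "(\<chi> r. \<xi> (\<omega> (g r))) *v v = 0"
        by (simp add: matrix_vector_mul_component vec_eq_iff)
      then show "v = 0"
        by (metis inv matrix_inv_invertible(2) matrix_vector_mul_assoc matrix_vector_mul_lid
            matrix_vector_mult_0_right)
    qed
  qed
qed


section \<open>Expectation of the quadratic form in the errors\<close>

lemma abs_mult_le_sum_squares: "\<bar>a * b\<bar> \<le> a\<^sup>2 + b\<^sup>2" for a b :: real
proof -
  have "2 * \<bar>a\<bar> * \<bar>b\<bar> \<le> a\<^sup>2 + b\<^sup>2"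
    using sum_squares_bound[of "\<bar>a\<bar>" "\<bar>b\<bar>"] by simp
  moreover have "0 \<le> \<bar>a\<bar> * \<bar>b\<bar>" by simp
  ultimately show ?thesis unfolding abs_mult by linarith
qed

text \<open>\<open>orth\<close> and \<open>homo\<close> express conditional mean 0 and conditional
  second moment \<tau> of the error given the covariates in \<open>S\<close>. When all observations
  but the i-th are frozen, the coefficient of w_i w_j becomes an admissible test function. Off the
  diagonal w_j is frozen too, and \<open>orth\<close> annihilates the term; on the diagonal
  \<open>homo\<close> replaces the squared error by \<tau>, and what remains is the expected
  trace.\<close>

lemma expected_rss:
  fixes L :: "((real^'p) \<times> real) measure" and c :: "real^'p" and S :: "'p set" and \<tau> :: real
  defines "w \<equiv> \<lambda>t. snd t - fst t \<bullet> c"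
    and "X \<equiv> \<lambda>\<omega> :: 'n::finite \<Rightarrow> (real^'p) \<times> real. (\<chi> i. fst (\<omega> i)) :: real^'p^'n"
    and "Y \<equiv> \<lambda>\<omega> :: 'n \<Rightarrow> (real^'p) \<times> real. (\<chi> i. snd (\<omega> i)) :: real^'n"
  assumes L: "prob_space L" and sets_L [measurable_cong]: "sets L = sets borel"
    and c: "subvec S c = c"
    and w2: "integrable L (\<lambda>t. (w t)\<^sup>2)"
    and orth: "\<And>h. h \<in> borel_measurable borel \<Longrightarrow> (\<And>z. \<bar>h z\<bar> \<le> 1) \<Longrightarrow>
      (\<integral>t. h (subvec S (fst t)) * w t \<partial>L) = 0"
    and homo: "\<And>h. h \<in> borel_measurable borel \<Longrightarrow> (\<And>z. \<bar>h z\<bar> \<le> 1) \<Longrightarrow>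
      (\<integral>t. h (subvec S (fst t)) * (w t)\<^sup>2 \<partial>L) = \<tau> * (\<integral>t. h (subvec S (fst t)) \<partial>L)"
    and nondeg: "\<And>a. a \<noteq> 0 \<Longrightarrow> AE t in L. a \<bullet> fst t \<noteq> 0"
    and card: "CARD('p) \<le> CARD('n)"
  shows "(\<integral>\<omega>. (norm (Y \<omega> - ls_fit S (X \<omega>) (Y \<omega>)))\<^sup>2 \<partial>PiM UNIV (\<lambda>_. L))
    = \<tau> * (real CARD('n) - real (card S))"
proof -
  let ?P = "PiM UNIV (\<lambda>_::'n. L)"
  interpret L: prob_space L by (rule L)
  interpret P: prob_space ?P by (rule prob_space_PiM) (rule L)
  \<comment> \<open>The truncation changes nothing on nonsingular designs, hence almost surely
    nothing. It supplies the bound for every sample, as the test functions in \<open>orth\<close>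
    and \<open>homo\<close> must be bounded everywhere.\<close>
  define clip where "clip a = max (-1) (min 1 a)" for a :: real
  have clip_le: "\<bar>clip a\<bar> \<le> 1" for a unfolding clip_def by auto
  have clip_id: "clip a = a" if "\<bar>a\<bar> \<le> 1" for a using that unfolding clip_def by auto
  have [measurable]: "clip \<in> borel_measurable borel" unfolding clip_def by measurable
  have [measurable]: "fst \<in> borel_measurable L" "snd \<in> borel_measurable L"
    by (simp_all add: measurable_cong_sets[OF sets_L refl] borel_prod[symmetric])
  have [measurable]: "w \<in> borel_measurable L" unfolding w_def by measurable
  have X_meas [measurable]: "(\<lambda>\<omega>. X \<omega> $ i $ j) \<in> borel_measurable ?P" for i j
    unfolding X_def by simp
  have R_meas [measurable]: "(\<lambda>\<omega>. resid S (X \<omega>) $ i $ j) \<in> borel_measurable ?P" for i j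
    by (rule borel_measurable_resid) (rule X_meas)
  have Y_meas [measurable]: "(\<lambda>\<omega>. Y \<omega> $ i) \<in> borel_measurable ?P" for i
    unfolding Y_def by simp
  define G where "G i j \<omega> = clip (resid S (X \<omega>) $ i $ j)" for i j \<omega>
  have G_meas [measurable]: "G i j \<in> borel_measurable ?P" for i j
    unfolding G_def by measurable
  have ns: "AE \<omega> in ?P. nonsing_on S (transpose (X \<omega>) ** X \<omega>)"
    unfolding X_def by (rule AE_PiM_gram_nonsing[OF L _ nondeg card]) measurable
  have distr_coord: "distr ?P L (\<lambda>\<omega>. \<omega> i) = L" for i
    by (rule distr_PiM_component) (auto intro: L)
  have w2_coord: "integrable ?P (\<lambda>\<omega>. (w (\<omega> i))\<^sup>2)" for i
    using w2 integrable_distr[of "\<lambda>\<omega>. \<omega> i" ?P L "\<lambda>t. (w t)\<^sup>2"]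
    by (simp only: distr_coord) simp
  have int: "integrable ?P (\<lambda>\<omega>. G i j \<omega> * (w (\<omega> i) * w (\<omega> j)))" for i j
  proof (rule Bochner_Integration.integrable_bound)
    show "integrable ?P (\<lambda>\<omega>. (w (\<omega> i))\<^sup>2 + (w (\<omega> j))\<^sup>2)" using w2_coord by simp
    show "AE \<omega> in ?P. norm (G i j \<omega> * (w (\<omega> i) * w (\<omega> j))) \<le> norm ((w (\<omega> i))\<^sup>2 + (w (\<omega> j))\<^sup>2)"
    proof (rule AE_I2)
      fix \<omega>
      have "\<bar>G i j \<omega>\<bar> * \<bar>w (\<omega> i) * w (\<omega> j)\<bar> \<le> 1 * \<bar>w (\<omega> i) * w (\<omega> j)\<bar>"
        unfolding G_def by (rule mult_right_mono[OF clip_le]) simp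
      also have "\<dots> \<le> (w (\<omega> i))\<^sup>2 + (w (\<omega> j))\<^sup>2"
        using abs_mult_le_sum_squares by simp
      finally show "norm (G i j \<omega> * (w (\<omega> i) * w (\<omega> j))) \<le> norm ((w (\<omega> i))\<^sup>2 + (w (\<omega> j))\<^sup>2)"
        by (simp add: abs_mult)
    qed
  qed measurable
  \<comment> \<open>As a function of the \<open>i\<close>-th observation alone, \<open>G i j\<close> depends only on the covariates in \<open>S\<close>.\<close>
  define h where "h i j \<omega> z = clip (resid S (\<chi> r. if r = i then z else fst (\<omega> r)) $ i $ j)"
    for i j :: 'n and \<omega> :: "'n \<Rightarrow> (real^'p) \<times> real" and z
  have h_meas: "h i j \<omega> \<in> borel_measurable borel" for i j \<omega>
  proof -
    have "(\<lambda>z. resid S (\<chi> r. if r = i then z else fst (\<omega> r)) $ i $ j) \<in> borel_measurable borel"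
      by (rule borel_measurable_resid) simp
    then show ?thesis unfolding h_def by measurable
  qed
  have h_le: "\<bar>h i j \<omega> z\<bar> \<le> 1" for i j \<omega> z unfolding h_def by (rule clip_le)
  have G_upd: "G i j (fun_upd \<omega> i t) = h i j \<omega> (subvec S (fst t))" for i j \<omega> t
  proof -
    have "resid S (X (fun_upd \<omega> i t))
        = resid S (\<chi> r. if r = i then subvec S (fst t) else fst (\<omega> r))"
      by (rule resid_cong_subvec) (simp add: X_def)
    then show ?thesis by (simp add: G_def h_def)
  qed
  have off_diag: "(\<integral>\<omega>. G i j \<omega> * (w (\<omega> i) * w (\<omega> j)) \<partial>?P) = 0" if "i \<noteq> j" for i j
  proof -
    have "(\<integral>\<omega>. G i j \<omega> * (w (\<omega> i) * w (\<omega> j)) \<partial>?P)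
        = (\<integral>\<omega>. (\<integral>t. h i j \<omega> (subvec S (fst t)) * w t * w (\<omega> j) \<partial>L) \<partial>?P)"
      using that by (subst integral_PiM_resample[where k = i, OF L int]) (simp add: G_upd mult.assoc)
    also have "\<dots> = (\<integral>\<omega>. 0 \<partial>?P)"
      using orth[OF h_meas h_le] by simp
    finally show ?thesis by simp
  qed
  have diag: "(\<integral>\<omega>. G i i \<omega> * (w (\<omega> i) * w (\<omega> i)) \<partial>?P) = \<tau> * (\<integral>\<omega>. G i i \<omega> \<partial>?P)" for i
  proof -
    have Gint: "integrable ?P (G i i)"
      by (rule P.integrable_const_bound[of _ 1]) (auto simp: G_def clip_le)
    have "(\<integral>\<omega>. G i i \<omega> * (w (\<omega> i) * w (\<omega> i)) \<partial>?P)
        = (\<integral>\<omega>. (\<integral>t. h i i \<omega> (subvec S (fst t)) * (w t)\<^sup>2 \<partial>L) \<partial>?P)"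
      by (subst integral_PiM_resample[where k = i, OF L int]) (simp add: G_upd power2_eq_square)
    \<comment> \<open>After \<open>homo\<close> has removed the squared error from the inner
      integral, the resampling identity is read backwards to recover the expectation of
      \<open>G i i\<close>.\<close>
    also have "\<dots> = \<tau> * (\<integral>\<omega>. (\<integral>t. G i i (fun_upd \<omega> i t) \<partial>L) \<partial>?P)"
      by (simp add: homo[OF h_meas h_le] G_upd)
    also have "\<dots> = \<tau> * (\<integral>\<omega>. G i i \<omega> \<partial>?P)"
      by (simp only: integral_PiM_resample[where k = i, OF L Gint])
    finally show ?thesis .
  qed
  have "(\<integral>\<omega>. (norm (Y \<omega> - ls_fit S (X \<omega>) (Y \<omega>)))\<^sup>2 \<partial>?P)
      = (\<integral>\<omega>. (\<Sum>i\<in>UNIV. \<Sum>j\<in>UNIV. G i j \<omega> * (w (\<omega> i) * w (\<omega> j))) \<partial>?P)"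
  proof (rule integral_cong_AE)
    show "(\<lambda>\<omega>. (norm (Y \<omega> - ls_fit S (X \<omega>) (Y \<omega>)))\<^sup>2) \<in> borel_measurable ?P"
      by (rule borel_measurable_rss) (rule X_meas Y_meas)+
    show "AE \<omega> in ?P. (norm (Y \<omega> - ls_fit S (X \<omega>) (Y \<omega>)))\<^sup>2
        = (\<Sum>i\<in>UNIV. \<Sum>j\<in>UNIV. G i j \<omega> * (w (\<omega> i) * w (\<omega> j)))"
      using ns
    proof (rule AE_mp[OF _ AE_I2[OF impI]])
      fix \<omega> assume n: "nonsing_on S (transpose (X \<omega>) ** X \<omega>)"
      have "(Y \<omega> - X \<omega> *v c) $ i = w (\<omega> i)" for i
        by (simp add: X_def Y_def w_def matrix_vector_mul_component)
      then show "(norm (Y \<omega> - ls_fit S (X \<omega>) (Y \<omega>)))\<^sup>2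
          = (\<Sum>i\<in>UNIV. \<Sum>j\<in>UNIV. G i j \<omega> * (w (\<omega> i) * w (\<omega> j)))"
        unfolding rss_quadratic_form[OF n c] G_def
        by (simp add: clip_id[OF resid_entry_le_1[OF n]] mult.assoc)
    qed
  qed measurable
  also have "\<dots> = (\<Sum>i\<in>UNIV. \<Sum>j\<in>UNIV. \<integral>\<omega>. G i j \<omega> * (w (\<omega> i) * w (\<omega> j)) \<partial>?P)"
    using int by simp
  also have "\<dots> = (\<Sum>i\<in>UNIV. \<Sum>j\<in>UNIV. if i = j then \<tau> * (\<integral>\<omega>. G i i \<omega> \<partial>?P) else 0)"
    using off_diag diag by (intro sum.cong) auto
  also have "\<dots> = \<tau> * (\<integral>\<omega>. (\<Sum>i\<in>UNIV. G i i \<omega>) \<partial>?P)"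
    by (subst Bochner_Integration.integral_sum)
       (auto intro!: P.integrable_const_bound[of _ 1] simp: G_def clip_le sum_distrib_left)
  also have "(\<integral>\<omega>. (\<Sum>i\<in>UNIV. G i i \<omega>) \<partial>?P) = (\<integral>\<omega>. real CARD('n) - real (card S) \<partial>?P)"
  proof (rule integral_cong_AE)
    show "AE \<omega> in ?P. (\<Sum>i\<in>UNIV. G i i \<omega>) = real CARD('n) - real (card S)"
      using ns
    proof (rule AE_mp[OF _ AE_I2[OF impI]])
      fix \<omega> assume n: "nonsing_on S (transpose (X \<omega>) ** X \<omega>)"
      show "(\<Sum>i\<in>UNIV. G i i \<omega>) = real CARD('n) - real (card S)"
        using trace_resid[OF n] by (simp add: G_def clip_id[OF resid_entry_le_1[OF n]] trace_def)
    qed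
  qed measurable
  also have "\<dots> = real CARD('n) - real (card S)" by (simp add: P.prob_space)
  finally show ?thesis .
qed

section \<open>The standard Gaussian measure\<close>

lemma lborel_distr_orthogonal:
  fixes f :: "'a::euclidean_space \<Rightarrow> 'a"
  assumes f: "orthogonal_transformation f"
  shows "distr lborel borel f = lborel"
proof (rule measure_eqI)
  have lin: "linear f" using f by (rule orthogonal_transformation_linear)
  have [measurable]: "f \<in> borel_measurable borel"
    using linear_continuous_on[of f UNIV] lin
    by (intro borel_measurable_continuous_onI) (simp add: linear_linear)
  have shift: "(\<integral>\<^sup>+x. F (x + c) \<partial>lborel) = (\<integral>\<^sup>+x. F x \<partial>lborel)"
    if [measurable]: "F \<in> borel_measurable borel" for F :: "'a \<Rightarrow> ennreal" and c
    by (subst (2) lborel_distr_plus[symmetric, of c]) (simp add: nn_integral_distr add.commute)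
  have reflect: "(\<integral>\<^sup>+x. F (c - x) \<partial>lborel) = (\<integral>\<^sup>+x. F x \<partial>lborel)"
    if [measurable]: "F \<in> borel_measurable borel" for F :: "'a \<Rightarrow> ennreal" and c
    by (subst (2) lborel_affine[of "-1" c]) (simp_all add: nn_integral_density nn_integral_distr)
  fix E assume "E \<in> sets (distr lborel borel f)"
  then have E [measurable]: "E \<in> sets borel" by simp
  \<comment> \<open>The uniqueness argument for Haar measure: integrate \<open>1\<^sub>E (f x) * 1\<^sub>B (f x + y)\<close> over \<open>x\<close> and
    \<open>y\<close> in both orders. The proportionality constant is 1 because \<open>f\<close> preserves the unit ball \<open>B\<close>.\<close>
  let ?B = "ball 0 1 :: 'a set"
  have [measurable]: "?B \<in> sets borel" by simp
  let ?\<mu> = "emeasure (distr lborel borel f) E"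
  have B: "emeasure lborel ?B \<noteq> 0" "emeasure lborel ?B \<noteq> \<infinity>"
    using emeasure_lborel_ball_finite[of "0::'a" 1] content_ball_pos[of 1 "0::'a"]
    by (auto simp: measure_def)
  obtain g where g: "\<And>y. f (g y) = y"
    using orthogonal_transformation_surj[OF f] by (metis surj_def)
  have "?\<mu> * emeasure lborel ?B
      = (\<integral>\<^sup>+x. indicator E (f x) * emeasure lborel ?B \<partial>lborel)"
  proof -
    have "?\<mu> = (\<integral>\<^sup>+x. indicator E x \<partial>distr lborel borel f)"
      by simp
    also have "\<dots> = (\<integral>\<^sup>+x. indicator E (f x) \<partial>lborel)"
      by (rule nn_integral_distr) measurable
    finally show ?thesis by (simp add: nn_integral_multc)
  qed
  also have "\<dots> = (\<integral>\<^sup>+x. (\<integral>\<^sup>+y. indicator E (f x) * indicator ?B (f x + y) \<partial>lborel) \<partial>lborel)"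
  proof (rule nn_integral_cong)
    fix x
    have "(\<integral>\<^sup>+y. indicator ?B (f x + y) \<partial>lborel) = emeasure lborel ?B"
      using shift[of "indicator ?B" "f x"]
      by (simp add: add.commute[of "f x"] borel_measurable_indicator)
    moreover have "(\<integral>\<^sup>+y. indicator E (f x) * indicator ?B (f x + y) \<partial>lborel)
        = indicator E (f x) * (\<integral>\<^sup>+y. indicator ?B (f x + y) \<partial>lborel)"
      by (rule nn_integral_cmult) measurable
    ultimately show "indicator E (f x) * emeasure lborel ?B
        = (\<integral>\<^sup>+y. indicator E (f x) * indicator ?B (f x + y) \<partial>lborel)"
      by (simp only:)
  qed
  also have "\<dots> = (\<integral>\<^sup>+y. (\<integral>\<^sup>+x. indicator E (f x) * indicator ?B (f x + y) \<partial>lborel) \<partial>lborel)"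
    by (rule lborel_pair.Fubini') measurable
  also have "\<dots> = (\<integral>\<^sup>+y. (\<integral>\<^sup>+x. indicator E (f x - y) * indicator ?B (f x) \<partial>lborel) \<partial>lborel)"
  proof (rule nn_integral_cong)
    fix y
    \<comment> \<open>A preimage of -y under \<open>f\<close> pulls the shift back to the argument,
      where translation invariance of Lebesgue measure applies.\<close>
    have "f (x + g (- y)) = f x - y" for x using linear_add[OF lin] g by simp
    then show "(\<integral>\<^sup>+x. indicator E (f x) * indicator ?B (f x + y) \<partial>lborel)
        = (\<integral>\<^sup>+x. indicator E (f x - y) * indicator ?B (f x) \<partial>lborel)"
      using shift[of "\<lambda>x. indicator E (f x) * indicator ?B (f x + y)" "g (- y)"] by simp
  qed
  also have "\<dots> = (\<integral>\<^sup>+x. (\<integral>\<^sup>+y. indicator E (f x - y) * indicator ?B (f x) \<partial>lborel) \<partial>lborel)"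
    by (rule lborel_pair.Fubini') measurable
  also have "\<dots> = (\<integral>\<^sup>+x. emeasure lborel E * indicator ?B x \<partial>lborel)"
  proof (rule nn_integral_cong)
    fix x
    have "(\<integral>\<^sup>+y. indicator E (f x - y) \<partial>lborel) = emeasure lborel E"
      using reflect[of "indicator E" "f x"] by (simp add: borel_measurable_indicator)
    moreover have "indicator ?B (f x) = (indicator ?B x :: ennreal)"
      using orthogonal_transformation_norm[OF f] by (simp add: indicator_def)
    ultimately show "(\<integral>\<^sup>+y. indicator E (f x - y) * indicator ?B (f x) \<partial>lborel)
        = emeasure lborel E * indicator ?B x"
      by (simp add: nn_integral_multc)
  qed
  also have "\<dots> = emeasure lborel E * emeasure lborel ?B"
    by (simp add: nn_integral_cmult)
  finally have "emeasure lborel ?B * ?\<mu> = emeasure lborel ?B * emeasure lborel E"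
    by (simp add: mult.commute)
  then show "?\<mu> = emeasure lborel E"
    using B by (simp add: ennreal_mult_cancel_left)
qed simp

text \<open>The density is radial; together with the invariance of Lebesgue measure this makes the
  Gaussian measure rotation invariant.\<close>

lemma std_normal_density_prod:
  "(\<Prod>i\<in>UNIV. std_normal_density (z $ i))
    = (1 / sqrt (2 * pi)) ^ CARD('p) * exp (- (norm z)\<^sup>2 / 2)" for z :: "real^'p"
proof -
  have "(norm z)\<^sup>2 = (\<Sum>i\<in>UNIV. (z $ i)\<^sup>2)"
    by (simp only: power2_norm_eq_inner) (simp add: inner_vec_def power2_eq_square)
  then have "exp (- (norm z)\<^sup>2 / 2) = (\<Prod>i\<in>UNIV. exp (- (z $ i)\<^sup>2 / 2))"
    by (simp add: exp_sum[symmetric] sum_negf sum_divide_distrib)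
  then show ?thesis by (simp add: std_normal_density_def prod_dividef power_one_over)
qed

lemma sets_std_gauss [simp, measurable_cong]: "sets std_gauss = sets borel"
  by (simp add: std_gauss_def)

lemma space_std_gauss [simp]: "space std_gauss = UNIV"
  by (simp add: std_gauss_def)

lemma std_gauss_distr_orthogonal:
  fixes f :: "real^'p \<Rightarrow> real^'p"
  assumes f: "orthogonal_transformation f"
  shows "distr std_gauss borel f = std_gauss"
proof (rule measure_eqI)
  have [measurable]: "f \<in> borel_measurable borel"
    using linear_continuous_on[of f UNIV] orthogonal_transformation_linear[OF f]
    by (intro borel_measurable_continuous_onI) (simp add: linear_linear)
  let ?d = "\<lambda>z::real^'p. ennreal (\<Prod>i\<in>UNIV. std_normal_density (z $ i))"
  have d: "?d (f z) = ?d z" for z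
    by (simp only: std_normal_density_prod orthogonal_transformation_norm[OF f])
  fix E assume "E \<in> sets (distr std_gauss borel f)"
  then have [measurable]: "E \<in> sets borel" by simp
  have "emeasure (distr std_gauss borel f) E = (\<integral>\<^sup>+z. ?d z * indicator E (f z) \<partial>lborel)"
  proof -
    have "f -` E \<in> sets borel" using measurable_sets[of f borel borel E] by simp
    moreover have "indicator (f -` E) z = (indicator E (f z) :: ennreal)" for z
      by (simp add: indicator_def)
    ultimately show ?thesis
      by (simp add: emeasure_distr std_gauss_def emeasure_density)
  qed
  also have "\<dots> = (\<integral>\<^sup>+z. ?d z * indicator E z \<partial>distr lborel borel f)"
    by (subst nn_integral_distr) (simp_all add: d)
  also have "\<dots> = emeasure std_gauss E"
    by (simp add: lborel_distr_orthogonal[OF f] std_gauss_def emeasure_density)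
  finally show "emeasure (distr std_gauss borel f) E = emeasure std_gauss E" .
qed simp

section \<open>Coordinates of the standard Gaussian vector and factorization of integrals\<close>

lemma std_gauss_box:
  assumes [measurable]: "\<And>i. A i \<in> sets borel"
  shows "emeasure std_gauss {z :: real^'p. \<forall>i. z $ i \<in> A i}
    = (\<Prod>i\<in>UNIV. emeasure std_normal_distribution (A i))"
proof -
  \<comment> \<open>Product integration over Lebesgue measure is indexed by \<open>Basis\<close>,
    while the box is indexed by coordinates; \<open>idx\<close> translates a basis vector back into
    its coordinate.\<close>
  define idx :: "real^'p \<Rightarrow> 'p" where "idx b = (THE i. b = axis i 1)" for b
  have idx: "idx (axis i 1) = i" for i
    unfolding idx_def by (rule the_equality) (simp_all add: axis_eq_axis)
  have basis: "(\<Prod>b\<in>(Basis :: (real^'p) set). F b) = (\<Prod>i\<in>UNIV. F (axis i 1))"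
    for F :: "real^'p \<Rightarrow> ennreal"
  proof -
    have "(Basis :: (real^'p) set) = range (\<lambda>i. axis i 1)" by (auto simp: Basis_vec_def)
    moreover have "inj (\<lambda>i::'p. axis i (1::real))" by (auto simp: inj_def axis_eq_axis)
    ultimately show ?thesis using prod.reindex[of "\<lambda>i. axis i 1" UNIV F] by (simp add: comp_def)
  qed
  let ?f = "\<lambda>b t. ennreal (std_normal_density t) * indicator (A (idx b)) t"
  have "emeasure std_gauss {z :: real^'p. \<forall>i. z $ i \<in> A i}
      = (\<integral>\<^sup>+z. (\<Prod>b\<in>Basis. ?f b (z \<bullet> b)) \<partial>lborel)"
  proof -
    have [measurable]: "{z :: real^'p. \<forall>i. z $ i \<in> A i} \<in> sets borel" by measurable
    have "ennreal (\<Prod>i\<in>UNIV. std_normal_density (z $ i)) * indicator {z. \<forall>i. z $ i \<in> A i} z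
        = (\<Prod>b\<in>Basis. ?f b (z \<bullet> b))" for z :: "real^'p"
    proof -
      have "(indicator {z. \<forall>i. z $ i \<in> A i} z :: ennreal) = (\<Prod>i\<in>UNIV. indicator (A i) (z $ i))"
        by (auto simp: indicator_def prod_eq_1_iff prod_zero)
      then show ?thesis
        by (simp add: basis idx inner_axis prod.distrib prod_ennreal normal_density_nonneg)
    qed
    then show ?thesis by (simp add: std_gauss_def emeasure_density)
  qed
  also have "\<dots> = (\<Prod>b\<in>(Basis :: (real^'p) set). \<integral>\<^sup>+t. ?f b t \<partial>lborel)"
    by (rule nn_integral_lborel_prod) auto
  also have "\<dots> = (\<Prod>i\<in>UNIV. emeasure std_normal_distribution (A i))"
    by (simp add: basis idx emeasure_density)
  finally show ?thesis .
qed

lemma prob_space_std_normal: "prob_space std_normal_distribution"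
  by (rule prob_space_normal_density) simp

lemma prob_space_std_gauss: "prob_space (std_gauss :: (real^'p) measure)"
proof
  interpret N: prob_space std_normal_distribution by (rule prob_space_std_normal)
  show "emeasure (std_gauss :: (real^'p) measure) (space std_gauss) = 1"
    using std_gauss_box[of "\<lambda>_. UNIV"] N.emeasure_space_1 by simp
qed

lemma distr_std_gauss_coords:
  "distr (std_gauss :: (real^'p) measure) (PiM UNIV (\<lambda>_. borel)) (\<lambda>z. \<lambda>i\<in>UNIV. z $ i)
    = PiM UNIV (\<lambda>_. std_normal_distribution)"
proof -
  interpret product_prob_space "\<lambda>_. std_normal_distribution" UNIV
    using prob_space_std_normal
    by (simp add: product_prob_space_def product_prob_space_axioms_def
        product_sigma_finite_def prob_space_imp_sigma_finite)
  show ?thesis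
  proof (rule PiM_eqI)
    fix A :: "'p \<Rightarrow> real set"
    assume "\<And>i. i \<in> UNIV \<Longrightarrow> A i \<in> sets std_normal_distribution"
    then have A: "\<And>i. A i \<in> sets borel" by simp
    have "(\<lambda>z::real^'p. \<lambda>i\<in>UNIV. z $ i) -` Pi\<^sub>E UNIV A \<inter> space std_gauss = {z. \<forall>i. z $ i \<in> A i}"
      by (auto simp: PiE_iff)
    then show "emeasure (distr (std_gauss :: (real^'p) measure) (PiM UNIV (\<lambda>_. borel))
        (\<lambda>z. \<lambda>i\<in>UNIV. z $ i)) (Pi\<^sub>E UNIV A) = (\<Prod>i\<in>UNIV. emeasure std_normal_distribution (A i))"
      using A by (subst emeasure_distr) (auto simp: std_gauss_box intro!: sets_PiM_I_finite)
  qed (auto intro!: sets_PiM_cong)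
qed

lemma distr_std_gauss_coord:
  "distr (std_gauss :: (real^'p) measure) borel (\<lambda>z. z $ i) = std_normal_distribution"
proof -
  have "distr (std_gauss :: (real^'p) measure) borel (\<lambda>z. z $ i)
      = distr (distr (std_gauss :: (real^'p) measure) (PiM UNIV (\<lambda>_. borel)) (\<lambda>z. \<lambda>i\<in>UNIV. z $ i))
          borel (\<lambda>\<omega>. \<omega> i)"
    by (subst distr_distr) (auto simp: comp_def)
  also have "\<dots> = distr (PiM UNIV (\<lambda>_::'p. std_normal_distribution)) std_normal_distribution (\<lambda>\<omega>. \<omega> i)"
    unfolding distr_std_gauss_coords by (rule distr_cong) auto
  also have "\<dots> = std_normal_distribution"
    by (rule distr_PiM_component) (auto intro: prob_space_std_normal)
  finally show ?thesis .
qed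

lemma indep_vars_std_gauss:
  "prob_space.indep_vars std_gauss (\<lambda>_. borel) (\<lambda>i (z::real^'p). z $ i) UNIV"
proof -
  interpret prob_space "std_gauss :: (real^'p) measure" by (rule prob_space_std_gauss)
  show ?thesis
    by (subst indep_vars_iff_distr_eq_PiM)
      (auto simp only: distr_std_gauss_coords distr_std_gauss_coord, measurable)
qed

text \<open>\<open>g q = 0\<close> expresses that g(z) and q . z are uncorrelated. A rotation f that
  carries a coordinate axis to the direction of \<open>q\<close> turns q . f(z) into a multiple of
  z_k, whereas g(f z) no longer sees z_k because \<open>g\<close> kills \<open>q\<close>.
  Independence of disjoint sets of coordinates then factors the integral. For \<open>q = 0\<close>
  the second factor is a constant.\<close>

lemma std_gauss_integral_mult:
  fixes g :: "real^'p \<Rightarrow> 'c::euclidean_space" and q :: "real^'p"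
    and h :: "'c \<Rightarrow> real" and \<phi> :: "real \<Rightarrow> real"
  assumes g: "linear g" and gq: "g q = 0"
    and h [measurable]: "h \<in> borel_measurable borel" and hb: "\<And>z. \<bar>h z\<bar> \<le> C"
    and \<phi> [measurable]: "\<phi> \<in> borel_measurable borel"
    and int: "integrable std_gauss (\<lambda>z. \<phi> (q \<bullet> z))"
  shows "(\<integral>z. h (g z) * \<phi> (q \<bullet> z) \<partial>std_gauss)
    = (\<integral>z. h (g z) \<partial>std_gauss) * (\<integral>z. \<phi> (q \<bullet> z) \<partial>std_gauss)"
proof (cases "q = 0")
  case True
  interpret prob_space "std_gauss :: (real^'p) measure" by (rule prob_space_std_gauss)
  from True show ?thesis using prob_space by simp
next
  case False
  interpret prob_space "std_gauss :: (real^'p) measure" by (rule prob_space_std_gauss)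
  obtain k :: 'p where True by blast
  have "norm (axis k (norm q) :: real^'p) = norm q"
    by (simp add: norm_eq_sqrt_inner[of "axis k _"] inner_axis_axis)
  then obtain f where f: "orthogonal_transformation f" and fq: "f (axis k (norm q)) = q"
    by (rule orthogonal_transformation_exists)
  have lin: "linear f" using f by (rule orthogonal_transformation_linear)
  have meas_lin: "l \<in> borel_measurable borel"
    if "linear l" for l :: "real^'p \<Rightarrow> 'd::euclidean_space"
    using linear_continuous_on[of l UNIV] that
    by (intro borel_measurable_continuous_onI) (simp add: linear_linear)
  have [measurable]: "f \<in> borel_measurable borel" "g \<in> borel_measurable borel"
    using meas_lin[OF lin] meas_lin[OF g] .
  have rot: "(\<integral>z. F z \<partial>std_gauss) = (\<integral>z. F (f z) \<partial>std_gauss)"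
    if "F \<in> borel_measurable borel" for F :: "real^'p \<Rightarrow> real"
    using that by (subst std_gauss_distr_orthogonal[OF f, symmetric]) (simp add: integral_distr)
  have qf: "q \<bullet> f z = norm q * z $ k" for z
  proof -
    have "q \<bullet> f z = f (axis k (norm q)) \<bullet> f z" by (simp add: fq)
    also have "\<dots> = axis k (norm q) \<bullet> z" using f by (simp add: orthogonal_transformation_def)
    finally show ?thesis by (simp add: inner_axis')
  qed
  \<comment> \<open>Filling slot \<open>k\<close> with 0 exhibits \<open>h (g (f z))\<close> as a
    function of the remaining coordinates alone, the form required by independence of the two
    restrictions.\<close>
  define H where "H \<omega> = h (g (f (\<chi> i. if i = k then 0 else \<omega> i)))" for \<omega> :: "'p \<Rightarrow> real"
  have gf: "h (g (f z)) = H (\<lambda>i\<in>UNIV - {k}. z $ i)" for z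
  proof -
    have "norm q *\<^sub>R axis k 1 = (axis k (norm q) :: real^'p)"
      by (simp add: vec_eq_iff axis_def)
    then have "norm q *\<^sub>R g (f (axis k 1)) = g (f (axis k (norm q)))"
      by (metis linear_cmul[OF lin] linear_cmul[OF g])
    then have "g (f (axis k 1)) = 0" using False by (simp add: fq gq)
    moreover have "z = (\<chi> i. if i = k then 0 else z $ i) + z $ k *\<^sub>R axis k 1"
      by (simp add: vec_eq_iff axis_def)
    ultimately have "g (f z) = g (f (\<chi> i. if i = k then 0 else z $ i))"
      by (metis (no_types, lifting) add.right_neutral g lin linear_add linear_cmul scaleR_zero_right)
    moreover have "(\<chi> i. if i = k then 0 else z $ i)
        = (\<chi> i. if i = k then 0 else (\<lambda>i\<in>UNIV - {k}. z $ i) i)"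
      by (simp add: vec_eq_iff)
    ultimately show ?thesis unfolding H_def by simp
  qed
  have H_meas: "H \<in> borel_measurable (PiM (UNIV - {k}) (\<lambda>_. borel))"
  proof -
    have "(\<lambda>\<omega>. (\<chi> i. if i = k then 0 else \<omega> i) :: real^'p)
        \<in> borel_measurable (PiM (UNIV - {k}) (\<lambda>_. borel))"
      by (rule borel_measurable_vecI, rename_tac i, case_tac "i = k")
        (auto intro!: measurable_component_singleton)
    then show ?thesis unfolding H_def by measurable
  qed
  have "indep_var (PiM {k} (\<lambda>_. borel)) (\<lambda>z. \<lambda>i\<in>{k}. z $ i)
      (PiM (UNIV - {k}) (\<lambda>_. borel)) (\<lambda>z. \<lambda>i\<in>UNIV - {k}. z $ i)"
    by (rule indep_var_restrict[OF indep_vars_std_gauss]) auto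
  then have "indep_var borel ((\<lambda>\<omega>. \<phi> (norm q * \<omega> k)) \<circ> (\<lambda>z. \<lambda>i\<in>{k}. z $ i))
      borel (H \<circ> (\<lambda>z. \<lambda>i\<in>UNIV - {k}. z $ i))"
    by (rule indep_var_compose[OF _ _ H_meas]) measurable
  then have ind: "indep_var borel (\<lambda>z. \<phi> (q \<bullet> f z)) borel (\<lambda>z. h (g (f z)))"
    by (simp add: comp_def gf qf)
  have "integrable std_gauss (\<lambda>z. \<phi> (q \<bullet> f z))"
    using int integrable_distr[of f std_gauss borel "\<lambda>z. \<phi> (q \<bullet> z)"]
    by (simp add: std_gauss_distr_orthogonal[OF f])
  moreover have "integrable std_gauss (\<lambda>z. h (g (f z)))"
    by (rule integrable_const_bound[of _ C]) (auto simp: hb)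
  ultimately have "(\<integral>z. \<phi> (q \<bullet> f z) * h (g (f z)) \<partial>std_gauss)
      = (\<integral>z. \<phi> (q \<bullet> f z) \<partial>std_gauss) * (\<integral>z. h (g (f z)) \<partial>std_gauss)"
    using indep_var_lebesgue_integral[OF ind] by blast
  then show ?thesis
    by (subst (1 2 3) rot) (simp_all add: mult.commute)
qed

lemma std_gauss_coord_moments:
  fixes i :: "'p::finite"
  shows "integrable std_gauss (\<lambda>z::real^'p. (z $ i)\<^sup>2)"
    and "(\<integral>z. (z::real^'p) $ i \<partial>std_gauss) = 0"
proof -
  have *: "integrable std_normal_distribution (\<lambda>t. t\<^sup>2)" "(\<integral>t. t \<partial>std_normal_distribution) = 0"
    using integrable_std_normal_distribution_moment[of 2]
      integral_std_normal_distribution_moment_odd[of 1] by simp_all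
  show "integrable std_gauss (\<lambda>z::real^'p. (z $ i)\<^sup>2)"
    using *(1) unfolding distr_std_gauss_coord[of i, symmetric]
    by (subst (asm) integrable_distr_eq) auto
  show "(\<integral>z. (z::real^'p) $ i \<partial>std_gauss) = 0"
    using *(2) unfolding distr_std_gauss_coord[of i, symmetric]
    by (subst (asm) integral_distr) auto
qed

lemma AE_std_gauss_inner_nonzero:
  fixes b :: "real^'p"
  assumes "b \<noteq> 0"
  shows "AE z in std_gauss. b \<bullet> z \<noteq> 0"
proof -
  have "{z. b \<bullet> z = 0} \<in> null_sets lebesgue"
    using assms by (simp add: negligible_iff_null_sets[symmetric] negligible_hyperplane)
  then have "{z. b \<bullet> z = 0} \<in> null_sets lborel"
    by (subst (asm) null_sets_completion_iff) auto
  then have "AE z in lborel. b \<bullet> z \<noteq> 0"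
    by (subst (asm) AE_iff_null_sets) (auto elim: AE_mp)
  then show ?thesis
    unfolding std_gauss_def by (subst AE_density) (auto elim: AE_mp)
qed

section \<open>Covariances, conditional variances and normal vectors\<close>

lemma integrable_mult_square_integrable:
  fixes X Y :: "'a \<Rightarrow> real"
  assumes [measurable]: "X \<in> borel_measurable M" "Y \<in> borel_measurable M"
    and int: "integrable M (\<lambda>\<omega>. (X \<omega>)\<^sup>2)" "integrable M (\<lambda>\<omega>. (Y \<omega>)\<^sup>2)"
  shows "integrable M (\<lambda>\<omega>. X \<omega> * Y \<omega>)"
proof (rule Bochner_Integration.integrable_bound)
  show "integrable M (\<lambda>\<omega>. (X \<omega>)\<^sup>2 + (Y \<omega>)\<^sup>2)" using int by simp
  show "AE \<omega> in M. norm (X \<omega> * Y \<omega>) \<le> norm ((X \<omega>)\<^sup>2 + (Y \<omega>)\<^sup>2)"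
    using abs_mult_le_sum_squares by (intro AE_I2) simp
qed measurable

lemma integrable_square_add:
  fixes X Y :: "'a \<Rightarrow> real"
  assumes m: "X \<in> borel_measurable M" "Y \<in> borel_measurable M"
    and int: "integrable M (\<lambda>\<omega>. (X \<omega>)\<^sup>2)" "integrable M (\<lambda>\<omega>. (Y \<omega>)\<^sup>2)"
  shows "integrable M (\<lambda>\<omega>. (X \<omega> + Y \<omega>)\<^sup>2)"
  using integrable_mult_square_integrable[OF m int] int
  by (simp add: power2_sum mult.assoc)

lemma integrable_square_inner:
  fixes V :: "'a \<Rightarrow> real^'k"
  assumes V: "V \<in> borel_measurable M"
    and int: "\<And>k. integrable M (\<lambda>\<omega>. (V \<omega> $ k)\<^sup>2)"
  shows "integrable M (\<lambda>\<omega>. (a \<bullet> V \<omega>)\<^sup>2)"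
proof -
  have "integrable M (\<lambda>\<omega>. (\<Sum>k\<in>K. a $ k * V \<omega> $ k)\<^sup>2)" if "finite K" for K
    using that
  proof (induction K)
    case (insert k K)
    have "integrable M (\<lambda>\<omega>. (a $ k * V \<omega> $ k)\<^sup>2)"
      using int by (simp add: power_mult_distrib)
    then show ?case
      using insert V by (simp add: integrable_square_add)
  qed simp
  then show ?thesis by (simp add: inner_vec_def)
qed

context prob_space
begin

lemma cov_commute: "cov M X Y = cov M Y X"
  by (simp add: cov_def mult.commute)

lemma cov_cong_AE:
  assumes [measurable]: "X \<in> borel_measurable M" "X' \<in> borel_measurable M" "Y \<in> borel_measurable M"
    and AE: "AE \<omega> in M. X \<omega> = X' \<omega>"
  shows "cov M X Y = cov M X' Y"
proof -
  have "expectation X = expectation X'" using AE by (intro integral_cong_AE) auto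
  then show ?thesis unfolding cov_def using AE by (intro integral_cong_AE) auto
qed

lemma cov_eq:
  assumes m: "X \<in> borel_measurable M" "Y \<in> borel_measurable M"
    and int: "integrable M (\<lambda>\<omega>. (X \<omega>)\<^sup>2)" "integrable M (\<lambda>\<omega>. (Y \<omega>)\<^sup>2)"
  shows "cov M X Y = expectation (\<lambda>\<omega>. X \<omega> * Y \<omega>) - expectation X * expectation Y"
proof -
  have [simp]: "integrable M X" "integrable M Y" "integrable M (\<lambda>\<omega>. X \<omega> * Y \<omega>)"
    using square_integrable_imp_integrable integrable_mult_square_integrable m int by auto
  have "cov M X Y = expectation (\<lambda>\<omega>. X \<omega> * Y \<omega> - X \<omega> * expectation Y - expectation X * Y \<omega>
      + expectation X * expectation Y)"
    unfolding cov_def by (simp add: algebra_simps)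
  also have "\<dots> = expectation (\<lambda>\<omega>. X \<omega> * Y \<omega>) - expectation X * expectation Y"
    by (simp add: prob_space)
  finally show ?thesis .
qed

lemma cov_add_left:
  assumes m: "X \<in> borel_measurable M" "X' \<in> borel_measurable M" "Y \<in> borel_measurable M"
    and int: "integrable M (\<lambda>\<omega>. (X \<omega>)\<^sup>2)" "integrable M (\<lambda>\<omega>. (X' \<omega>)\<^sup>2)" "integrable M (\<lambda>\<omega>. (Y \<omega>)\<^sup>2)"
  shows "cov M (\<lambda>\<omega>. X \<omega> + X' \<omega>) Y = cov M X Y + cov M X' Y"
proof -
  have [simp]: "integrable M X" "integrable M X'" "integrable M (\<lambda>\<omega>. X \<omega> * Y \<omega>)"
      "integrable M (\<lambda>\<omega>. X' \<omega> * Y \<omega>)"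
    using square_integrable_imp_integrable integrable_mult_square_integrable m int by auto
  show ?thesis
    using m int integrable_square_add[OF m(1,2) int(1,2)]
    by (simp add: cov_eq algebra_simps)
qed

lemma cov_mult_left: "cov M (\<lambda>\<omega>. c * X \<omega>) Y = c * cov M X Y"
  by (simp add: cov_def right_diff_distrib[symmetric] mult.assoc)

lemma cov_inner_left:
  fixes V :: "'a \<Rightarrow> real^'k"
  assumes V: "V \<in> borel_measurable M" and Y: "Y \<in> borel_measurable M"
    and int: "\<And>k. integrable M (\<lambda>\<omega>. (V \<omega> $ k)\<^sup>2)" and int_Y: "integrable M (\<lambda>\<omega>. (Y \<omega>)\<^sup>2)"
  shows "cov M (\<lambda>\<omega>. a \<bullet> V \<omega>) Y = (\<Sum>k\<in>UNIV. a $ k * cov M (\<lambda>\<omega>. V \<omega> $ k) Y)"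
proof -
  \<comment> \<open>Square integrability of the partial sums is carried along in the induction
    because additivity of the covariance asks for it at each step.\<close>
  have "cov M (\<lambda>\<omega>. \<Sum>k\<in>K. a $ k * V \<omega> $ k) Y = (\<Sum>k\<in>K. a $ k * cov M (\<lambda>\<omega>. V \<omega> $ k) Y)
      \<and> integrable M (\<lambda>\<omega>. (\<Sum>k\<in>K. a $ k * V \<omega> $ k)\<^sup>2)" if "finite K" for K
    using that
  proof (induction K)
    case empty
    show ?case by (simp add: cov_def)
  next
    case (insert k K)
    have 1: "integrable M (\<lambda>\<omega>. (a $ k * V \<omega> $ k)\<^sup>2)"
      using int by (simp add: power_mult_distrib)
    have 2: "(\<lambda>\<omega>. a $ k * V \<omega> $ k) \<in> borel_measurable M"
        "(\<lambda>\<omega>. \<Sum>k\<in>K. a $ k * V \<omega> $ k) \<in> borel_measurable M" using V by simp_all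
    show ?case
      using insert cov_add_left[OF 2 Y 1 _ int_Y] integrable_square_add[OF 2 1]
      by (simp add: cov_mult_left)
  qed
  then show ?thesis by (simp add: inner_vec_def)
qed

lemma cov_inner_inner:
  fixes V :: "'a \<Rightarrow> real^'k"
  assumes V: "V \<in> borel_measurable M" and int: "\<And>k. integrable M (\<lambda>\<omega>. (V \<omega> $ k)\<^sup>2)"
  shows "cov M (\<lambda>\<omega>. a \<bullet> V \<omega>) (\<lambda>\<omega>. b \<bullet> V \<omega>) = a \<bullet> (cov_mat M V *v b)"
proof -
  have "cov M (\<lambda>\<omega>. V \<omega> $ k) (\<lambda>\<omega>. b \<bullet> V \<omega>) = (cov_mat M V *v b) $ k" for k
    using cov_inner_left[where Y = "\<lambda>\<omega>. V \<omega> $ k" and a = b, OF V _ int int] V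
    by (simp add: cov_commute[of "\<lambda>\<omega>. V \<omega> $ k"] cov_mat_def matrix_vector_mult_def mult.commute)
  then show ?thesis
    using V by (subst cov_inner_left[OF V _ int integrable_square_inner[OF V int]])
      (simp_all add: inner_vec_def)
qed

lemma cov_self_nonneg: "0 \<le> cov M X X"
  by (simp add: cov_def)

section \<open>Conditional expectation given a random vector\<close>

lemma gen_alg_subalgebra:
  fixes r :: "'a \<Rightarrow> 'b::euclidean_space"
  assumes "r \<in> borel_measurable M"
  shows "sigma_finite_subalgebra M (gen_alg M r)"
proof (rule finite_measure_subalgebra_is_sigma_finite)
  have "subalgebra M (gen_alg M r)"
    using assms by (auto simp: subalgebra_def gen_alg_def sets_vimage_algebra2)
  then show "finite_measure_subalgebra M (gen_alg M r)"
    by (simp add: finite_measure_subalgebra_def finite_measure_subalgebra_axioms_def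
        finite_measure_axioms)
qed

lemma measurable_gen_alg: "r \<in> borel_measurable (gen_alg M r)"
  unfolding gen_alg_def by (rule measurable_vimage_algebra1) auto

text \<open>Integrability is asked of the product only, so \<open>g\<close> may be unbounded. The
  cross term between the projection residual and \<epsilon> is the case
  \<open>g v = h (subvec S v) * (a \<bullet> v)\<close>.\<close>

lemma integral_mult_const_cond_exp:
  fixes r :: "'a \<Rightarrow> 'b::euclidean_space" and g :: "'b \<Rightarrow> real"
  assumes r [measurable]: "r \<in> borel_measurable M" and e [measurable]: "e \<in> borel_measurable M"
    and g [measurable]: "g \<in> borel_measurable borel"
    and int: "integrable M (\<lambda>\<omega>. g (r \<omega>) * e \<omega>)"
    and const: "AE \<omega> in M. real_cond_exp M (gen_alg M r) e \<omega> = c"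
  shows "expectation (\<lambda>\<omega>. g (r \<omega>) * e \<omega>) = c * expectation (\<lambda>\<omega>. g (r \<omega>))"
proof -
  interpret S: sigma_finite_subalgebra M "gen_alg M r" by (rule gen_alg_subalgebra) (rule r)
  have "(\<lambda>\<omega>. g (r \<omega>)) \<in> borel_measurable (gen_alg M r)"
    using measurable_compose[OF measurable_gen_alg g] .
  then have "expectation (\<lambda>\<omega>. g (r \<omega>) * e \<omega>)
      = expectation (\<lambda>\<omega>. g (r \<omega>) * real_cond_exp M (gen_alg M r) e \<omega>)"
    using S.real_cond_exp_intg(2)[OF int _ e] by simp
  also have "\<dots> = expectation (\<lambda>\<omega>. g (r \<omega>) * c)"
    using const by (intro integral_cong_AE) auto
  finally show ?thesis by simp
qed

text \<open>Every event of the generated algebra is a preimage of a Borel set under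
  \<open>r\<close>, so indicators are enough as test functions. With them, \<open>orth\<close>
  identifies l(r) as the conditional expectation of l(r) + v, and \<open>homo\<close> identifies the
  conditional second moment of the deviation v.\<close>

lemma cond_var_eq_const:
  fixes r :: "'a \<Rightarrow> 'b::euclidean_space" and l :: "'b \<Rightarrow> real"
  assumes r [measurable]: "r \<in> borel_measurable M" and v [measurable]: "v \<in> borel_measurable M"
    and l [measurable]: "l \<in> borel_measurable borel"
    and lr: "integrable M (\<lambda>\<omega>. l (r \<omega>))" and v2: "integrable M (\<lambda>\<omega>. (v \<omega>)\<^sup>2)"
    and orth: "\<And>h. h \<in> borel_measurable borel \<Longrightarrow> (\<And>z. \<bar>h z\<bar> \<le> 1) \<Longrightarrow>
      expectation (\<lambda>\<omega>. h (r \<omega>) * v \<omega>) = 0"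
    and homo: "\<And>h. h \<in> borel_measurable borel \<Longrightarrow> (\<And>z. \<bar>h z\<bar> \<le> 1) \<Longrightarrow>
      expectation (\<lambda>\<omega>. h (r \<omega>) * (v \<omega>)\<^sup>2) = s * expectation (\<lambda>\<omega>. h (r \<omega>))"
  shows "AE \<omega> in M. cond_var M (gen_alg M r) (\<lambda>\<omega>. l (r \<omega>) + v \<omega>) \<omega> = s"
proof -
  interpret S: sigma_finite_subalgebra M "gen_alg M r" by (rule gen_alg_subalgebra) (rule r)
  let ?F = "gen_alg M r"
  have v1: "integrable M v" using square_integrable_imp_integrable[OF v v2] .
  have restr: "(\<integral>\<omega>\<in>A. G \<omega> \<partial>M) = expectation (\<lambda>\<omega>. indicator B (r \<omega>) * G \<omega>)"
    if "A = r -` B \<inter> space M" for A B and G :: "'a \<Rightarrow> real"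
    unfolding set_lebesgue_integral_def that
    by (intro Bochner_Integration.integral_cong) (auto simp: indicator_def)
  have F_sets: "\<exists>B\<in>sets borel. A = r -` B \<inter> space M" if "A \<in> sets ?F" for A
    using that by (auto simp: gen_alg_def sets_vimage_algebra2)
  have l_F: "(\<lambda>\<omega>. l (r \<omega>)) \<in> borel_measurable ?F"
    using measurable_compose[OF measurable_gen_alg l] .
  have "AE \<omega> in M. real_cond_exp M ?F (\<lambda>\<omega>. l (r \<omega>) + v \<omega>) \<omega> = l (r \<omega>)"
  proof (rule S.real_cond_exp_charact)
    fix A assume "A \<in> sets ?F"
    then obtain B where B [measurable]: "B \<in> sets borel" and A: "A = r -` B \<inter> space M"
      using F_sets by blast
    have "integrable M (\<lambda>\<omega>. indicator B (r \<omega>) * l (r \<omega>))"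
      by (rule Bochner_Integration.integrable_bound[OF lr]) (auto simp: indicator_def)
    moreover have "integrable M (\<lambda>\<omega>. indicator B (r \<omega>) * v \<omega>)"
      by (rule Bochner_Integration.integrable_bound[OF v1]) (auto simp: indicator_def)
    ultimately
    show "(\<integral>\<omega>\<in>A. (l (r \<omega>) + v \<omega>) \<partial>M) = (\<integral>\<omega>\<in>A. l (r \<omega>) \<partial>M)"
      using orth[of "indicator B"] by (simp add: restr[OF A] distrib_left indicator_def)
  qed (use lr v1 l_F in auto)
  then have dev: "AE \<omega> in M. (l (r \<omega>) + v \<omega> - real_cond_exp M ?F (\<lambda>\<omega>. l (r \<omega>) + v \<omega>) \<omega>)\<^sup>2 = (v \<omega>)\<^sup>2"
    by eventually_elim simp
  have "AE \<omega> in M. real_cond_exp M ?F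
      (\<lambda>\<omega>. (l (r \<omega>) + v \<omega> - real_cond_exp M ?F (\<lambda>\<omega>. l (r \<omega>) + v \<omega>) \<omega>)\<^sup>2) \<omega>
    = real_cond_exp M ?F (\<lambda>\<omega>. (v \<omega>)\<^sup>2) \<omega>"
    by (rule S.real_cond_exp_cong[OF dev]) measurable
  moreover have "AE \<omega> in M. real_cond_exp M ?F (\<lambda>\<omega>. (v \<omega>)\<^sup>2) \<omega> = s"
  proof (rule S.real_cond_exp_charact)
    fix A assume "A \<in> sets ?F"
    then obtain B where B [measurable]: "B \<in> sets borel" and A: "A = r -` B \<inter> space M"
      using F_sets by blast
    show "(\<integral>\<omega>\<in>A. (v \<omega>)\<^sup>2 \<partial>M) = (\<integral>\<omega>\<in>A. s \<partial>M)"
      using homo[of "indicator B"] by (simp add: restr[OF A] indicator_def mult.commute)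
  qed (use v2 in auto)
  ultimately show ?thesis unfolding cond_var_def by eventually_elim simp
qed

section \<open>Normal vectors as linear images of a standard Gaussian vector\<close>

lemma multivariate_normal_integral:
  fixes x :: "'a \<Rightarrow> real^'p" and F :: "real^'p \<Rightarrow> real"
  assumes x [measurable]: "x \<in> borel_measurable M"
    and D: "distr M borel x = distr std_gauss borel (\<lambda>z. A *v z)"
    and F [measurable]: "F \<in> borel_measurable borel"
  shows "expectation (\<lambda>\<omega>. F (x \<omega>)) = (\<integral>z. F (A *v z) \<partial>std_gauss)"
    and "integrable M (\<lambda>\<omega>. F (x \<omega>)) \<longleftrightarrow> integrable std_gauss (\<lambda>z. F (A *v z))"
    and "{z. Q z} \<in> sets borel \<Longrightarrow> (AE \<omega> in M. Q (x \<omega>)) \<longleftrightarrow> (AE z in std_gauss. Q (A *v z))"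
proof -
  have [measurable]: "(\<lambda>z. A *v z) \<in> borel_measurable std_gauss"
    by (intro borel_measurable_vecI) (simp add: matrix_vector_mult_def)
  show "expectation (\<lambda>\<omega>. F (x \<omega>)) = (\<integral>z. F (A *v z) \<partial>std_gauss)"
    by (subst integral_distr[symmetric, where N = borel and g = x])
      (simp_all add: D integral_distr)
  show "integrable M (\<lambda>\<omega>. F (x \<omega>)) \<longleftrightarrow> integrable std_gauss (\<lambda>z. F (A *v z))"
    by (subst integrable_distr_eq[symmetric, where N = borel and g = x])
      (simp_all add: D integrable_distr_eq)
  assume "{z. Q z} \<in> sets borel"
  then show "(AE \<omega> in M. Q (x \<omega>)) \<longleftrightarrow> (AE z in std_gauss. Q (A *v z))"
    using AE_distr_iff[OF x, of Q, unfolded D] AE_distr_iff[of "\<lambda>z. A *v z" std_gauss borel Q] by simp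
qed

lemma multivariate_normal_moments:
  fixes x :: "'a \<Rightarrow> real^'p"
  assumes N: "multivariate_normal M x 0 \<Sigma>"
  shows "integrable M (\<lambda>\<omega>. (x \<omega> $ i)\<^sup>2)" and "expectation (\<lambda>\<omega>. x \<omega> $ i) = 0"
proof -
  obtain A :: "real^'p^'p" where x: "x \<in> borel_measurable M"
    and D: "distr M borel x = distr std_gauss borel (\<lambda>z. A *v z)"
    using N unfolding multivariate_normal_def by auto
  interpret G: prob_space "std_gauss :: (real^'p) measure" by (rule prob_space_std_gauss)
  have eq: "(A *v z) $ i = A $ i \<bullet> z" for z by (simp add: matrix_vector_mul_component)
  have m: "(\<lambda>z. z) \<in> borel_measurable (std_gauss :: (real^'p) measure)" by simp
  show "integrable M (\<lambda>\<omega>. (x \<omega> $ i)\<^sup>2)"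
    using integrable_square_inner[OF m std_gauss_coord_moments(1), of "A $ i"]
    by (subst multivariate_normal_integral(2)[OF x D]) (simp_all add: eq)
  have "integrable std_gauss (\<lambda>z::real^'p. z $ k)" for k
    using G.square_integrable_imp_integrable[OF _ std_gauss_coord_moments(1)[of k]] by simp
  then have "(\<integral>z. A $ i \<bullet> z \<partial>std_gauss) = 0"
    by (simp add: inner_vec_def std_gauss_coord_moments(2))
  then show "expectation (\<lambda>\<omega>. x \<omega> $ i) = 0"
    by (subst multivariate_normal_integral(1)[OF x D]) (simp_all add: eq)
qed

text \<open>The condition on \<open>a\<close> says that a . x is uncorrelated with the covariates in
  \<open>S\<close>. Writing x as A z in law and \<Sigma> = A A', it becomes g q = 0 for g =
  \<open>subvec S\<close> after A and q = A' a, which is the Gaussian factorization.\<close>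

lemma multivariate_normal_integral_mult:
  fixes x :: "'a \<Rightarrow> real^'p" and h :: "real^'p \<Rightarrow> real" and \<phi> :: "real \<Rightarrow> real"
  assumes N: "multivariate_normal M x 0 \<Sigma>" and a: "subvec S (\<Sigma> *v a) = 0"
    and h [measurable]: "h \<in> borel_measurable borel" and hb: "\<And>z. \<bar>h z\<bar> \<le> 1"
    and \<phi> [measurable]: "\<phi> \<in> borel_measurable borel"
    and int: "integrable M (\<lambda>\<omega>. \<phi> (a \<bullet> x \<omega>))"
  shows "expectation (\<lambda>\<omega>. h (subvec S (x \<omega>)) * \<phi> (a \<bullet> x \<omega>))
    = expectation (\<lambda>\<omega>. h (subvec S (x \<omega>))) * expectation (\<lambda>\<omega>. \<phi> (a \<bullet> x \<omega>))"
proof -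
  obtain A :: "real^'p^'p" where x: "x \<in> borel_measurable M" and A: "A ** transpose A = \<Sigma>"
    and D: "distr M borel x = distr std_gauss borel (\<lambda>z. A *v z)"
    using N unfolding multivariate_normal_def by auto
  have lin: "linear (\<lambda>z. subvec S (A *v z))"
    by (rule linearI) (simp_all add: matrix_vector_right_distrib subvec_add matrix_vector_mult_scaleR
        vec_eq_iff)
  have q: "subvec S (A *v (transpose A *v a)) = 0"
    using a by (simp only: matrix_vector_mul_assoc A)
  have aA: "a \<bullet> (A *v z) = (transpose A *v a) \<bullet> z" for z
    by (metis matrix_vector_inner_transpose inner_commute)
  have "integrable std_gauss (\<lambda>z. \<phi> ((transpose A *v a) \<bullet> z))"
    using int multivariate_normal_integral(2)[OF x D, of "\<lambda>v. \<phi> (a \<bullet> v)"] by (simp add: aA)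
  from std_gauss_integral_mult[OF lin q h hb \<phi> this]
  show ?thesis
    using multivariate_normal_integral(1)[OF x D, of "\<lambda>v. \<phi> (a \<bullet> v)"]
      multivariate_normal_integral(1)[OF x D, of "\<lambda>v. h (subvec S v)"]
      multivariate_normal_integral(1)[OF x D, of "\<lambda>v. h (subvec S v) * \<phi> (a \<bullet> v)"]
    by (simp add: aA)
qed

text \<open>Invertibility of \<Sigma> = A A' makes A' injective. All three conclusions follow:
  \<Sigma> is a Gram matrix with trivial kernel, its quadratic form is the squared norm of A' a, and
  a . x has the law of (A' a) . z, which vanishes only on a null hyperplane.\<close>

lemma multivariate_normal_kernel:
  fixes x :: "'a \<Rightarrow> real^'p"
  assumes N: "multivariate_normal M x 0 \<Sigma>" and inv: "invertible \<Sigma>"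
  shows "nonsing_on S \<Sigma>"
    and "a \<noteq> 0 \<Longrightarrow> a \<bullet> (\<Sigma> *v a) > 0"
    and "a \<noteq> 0 \<Longrightarrow> AE \<omega> in M. a \<bullet> x \<omega> \<noteq> 0"
proof -
  obtain A :: "real^'p^'p" where x: "x \<in> borel_measurable M" and A: "A ** transpose A = \<Sigma>"
    and D: "distr M borel x = distr std_gauss borel (\<lambda>z. A *v z)"
    using N unfolding multivariate_normal_def by auto
  have ker: "v = 0" if "transpose A *v v = 0" for v
  proof -
    have "\<Sigma> *v v = 0" using that by (simp add: A[symmetric] matrix_vector_mul_assoc[symmetric])
    moreover have "matrix_inv \<Sigma> *v (\<Sigma> *v v) = v"
      by (simp only: matrix_vector_mul_assoc matrix_inv_invertible(2)[OF inv] matrix_vector_mul_lid)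
    ultimately show ?thesis by simp
  qed
  show "nonsing_on S \<Sigma>"
    using nonsing_on_gram[of "transpose A" S] ker by (simp add: A)
  have aA: "a \<bullet> (A *v z) = (transpose A *v a) \<bullet> z" for z
    by (metis matrix_vector_inner_transpose inner_commute)
  show "a \<bullet> (\<Sigma> *v a) > 0" if "a \<noteq> 0"
    using ker[of a] that aA[of "transpose A *v a"]
    by (auto simp: A[symmetric] matrix_vector_mul_assoc[symmetric])
  show "AE \<omega> in M. a \<bullet> x \<omega> \<noteq> 0" if "a \<noteq> 0"
  proof (subst multivariate_normal_integral(3)[OF x D, where Q = "\<lambda>z. a \<bullet> z \<noteq> 0"])
    show "AE z in std_gauss. a \<bullet> (A *v z) \<noteq> 0"
      unfolding aA using ker[of a] that by (intro AE_std_gauss_inner_nonzero) auto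
  qed measurable
qed

text \<open>Independence and equal laws say that the sample is distributed as the product of copies
  of the law of (x, y). Since the residual sum of squares is a measurable function of the sample,
  its expectation can be computed there.\<close>

lemma expected_rss_iid:
  fixes x :: "'a \<Rightarrow> real^'p" and y :: "'a \<Rightarrow> real"
    and xs :: "'n::finite \<Rightarrow> 'a \<Rightarrow> real^'p" and ys :: "'n \<Rightarrow> 'a \<Rightarrow> real"
  assumes x [measurable]: "x \<in> borel_measurable M" and y [measurable]: "y \<in> borel_measurable M"
    and indep: "indep_vars (\<lambda>_. borel) (\<lambda>i \<omega>. (xs i \<omega>, ys i \<omega>)) UNIV"
    and ident: "\<And>i. distr M borel (\<lambda>\<omega>. (xs i \<omega>, ys i \<omega>)) = distr M borel (\<lambda>\<omega>. (x \<omega>, y \<omega>))"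
    and c: "subvec S c = c"
    and w2: "integrable M (\<lambda>\<omega>. (y \<omega> - x \<omega> \<bullet> c)\<^sup>2)"
    and orth: "\<And>h. h \<in> borel_measurable borel \<Longrightarrow> (\<And>z. \<bar>h z\<bar> \<le> 1) \<Longrightarrow>
      expectation (\<lambda>\<omega>. h (subvec S (x \<omega>)) * (y \<omega> - x \<omega> \<bullet> c)) = 0"
    and homo: "\<And>h. h \<in> borel_measurable borel \<Longrightarrow> (\<And>z. \<bar>h z\<bar> \<le> 1) \<Longrightarrow>
      expectation (\<lambda>\<omega>. h (subvec S (x \<omega>)) * (y \<omega> - x \<omega> \<bullet> c)\<^sup>2)
        = \<tau> * expectation (\<lambda>\<omega>. h (subvec S (x \<omega>)))"
    and nondeg: "\<And>a. a \<noteq> 0 \<Longrightarrow> AE \<omega> in M. a \<bullet> x \<omega> \<noteq> 0"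
    and card: "CARD('p) \<le> CARD('n)"
  shows "expectation (\<lambda>\<omega>. (norm ((\<chi> i. ys i \<omega>) - ls_fit S (\<chi> i. xs i \<omega>) (\<chi> i. ys i \<omega>)))\<^sup>2)
    = \<tau> * (real CARD('n) - real (card S))"
proof -
  define L where "L = distr M borel (\<lambda>\<omega>. (x \<omega>, y \<omega>))"
  have xy [measurable]: "(\<lambda>\<omega>. (x \<omega>, y \<omega>)) \<in> borel_measurable M" by measurable
  have L: "prob_space L" unfolding L_def by (rule prob_space_distr) (rule xy)
  have sets_L [measurable_cong]: "sets L = sets borel" by (simp add: L_def)
  have fs [measurable]: "fst \<in> borel_measurable (borel :: ((real^'p) \<times> real) measure)"
      "snd \<in> borel_measurable (borel :: ((real^'p) \<times> real) measure)"
    by (simp_all add: borel_prod[symmetric])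
  have int_L: "(\<integral>t. F t \<partial>L) = expectation (\<lambda>\<omega>. F (x \<omega>, y \<omega>))"
    if "F \<in> borel_measurable borel" for F :: "(real^'p) \<times> real \<Rightarrow> real"
    unfolding L_def using that by (intro integral_distr) measurable
  have xys [measurable]: "(\<lambda>\<omega>. (xs i \<omega>, ys i \<omega>)) \<in> borel_measurable M" for i
    using indep by (auto simp: indep_vars_def)
  let ?P = "PiM UNIV (\<lambda>_::'n. L)"
  have PiM: "distr M (PiM UNIV (\<lambda>_. borel)) (\<lambda>\<omega>. \<lambda>i\<in>UNIV. (xs i \<omega>, ys i \<omega>)) = ?P"
    using indep by (subst (asm) indep_vars_iff_distr_eq_PiM) (auto simp: ident L_def)
  let ?\<Phi> = "\<lambda>\<omega>. (norm ((\<chi> i. snd (\<omega> i)) - ls_fit S (\<chi> i. fst (\<omega> i)) (\<chi> i. snd (\<omega> i))))\<^sup>2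
    :: real"
  have "?\<Phi> \<in> borel_measurable (PiM UNIV (\<lambda>_::'n. borel :: ((real^'p) \<times> real) measure))"
    by (rule borel_measurable_rss) simp_all
  then have "expectation (\<lambda>\<omega>. ?\<Phi> (\<lambda>i\<in>UNIV. (xs i \<omega>, ys i \<omega>))) = (\<integral>\<omega>. ?\<Phi> \<omega> \<partial>?P)"
    unfolding PiM[symmetric] by (subst integral_distr) (simp_all add: measurable_restrict)
  also have "\<dots> = \<tau> * (real CARD('n) - real (card S))"
  proof (rule expected_rss[OF L sets_L c])
    show "integrable L (\<lambda>t. (snd t - fst t \<bullet> c)\<^sup>2)"
      unfolding L_def using w2 by (subst integrable_distr_eq) simp_all
    show "AE t in L. a \<bullet> fst t \<noteq> 0" if "a \<noteq> 0" for a
      unfolding L_def using nondeg[OF that] by (subst AE_distr_iff) simp_all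
    show "(\<integral>t. h (subvec S (fst t)) * (snd t - fst t \<bullet> c) \<partial>L) = 0"
      if [measurable]: "h \<in> borel_measurable borel" and "\<And>z. \<bar>h z\<bar> \<le> 1" for h
      using orth[OF that] by (subst int_L) simp_all
    show "(\<integral>t. h (subvec S (fst t)) * (snd t - fst t \<bullet> c)\<^sup>2 \<partial>L)
        = \<tau> * (\<integral>t. h (subvec S (fst t)) \<partial>L)"
      if [measurable]: "h \<in> borel_measurable borel" and "\<And>z. \<bar>h z\<bar> \<le> 1" for h
      using homo[OF that] by (subst (1 2) int_L) simp_all
  qed (rule card)
  finally show ?thesis by simp
qed

end

section \<open>The residual of the projection on a block\<close>

text \<open>With \<Sigma> = \<Lambda> \<Lambda>' + U, the vector subtracted from \<open>b\<close> is
  the inverse of the \<open>R\<close> block of \<Sigma> applied to the \<open>R\<close> part of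
  \<Sigma> b, rewritten by the push-through identity so that only the block of \<open>U\<close> and
  a matrix of factor dimension are inverted. The verification rests on \<Lambda>' a = D \<Lambda>'
  b. Since b - a is supported on \<open>R\<close>, where \<Sigma> a vanishes, a . \<Sigma> a equals
  b . \<Sigma> a.\<close>

lemma factor_model_projection:
  fixes \<Lambda> :: "real^'k^'p" and U :: "real^'p^'p" and b :: "real^'p"
  assumes psd: "\<And>v. 0 \<le> v \<bullet> (U *v v)" and ns: "nonsing_on R U"
    and b: "subvec R b = 0"
    and block: "\<forall>i\<in>- R. \<forall>j\<in>R. U $ i $ j = 0 \<and> U $ j $ i = 0"
  defines "D \<equiv> matrix_inv (mat 1 + transpose \<Lambda> ** sub_inv R U ** \<Lambda>)"
  defines "a \<equiv> b - sub_inv R U *v (\<Lambda> *v (D *v (transpose \<Lambda> *v b)))"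
  shows "subvec R ((\<Lambda> ** transpose \<Lambda> + U) *v a) = 0"
    and "a \<bullet> ((\<Lambda> ** transpose \<Lambda> + U) *v a) = b \<bullet> ((\<Lambda> ** D ** transpose \<Lambda> + U) *v b)"
    and "subvec R (b - a) = b - a"
proof -
  let ?W = "sub_inv R U" and ?C = "mat 1 + transpose \<Lambda> ** sub_inv R U ** \<Lambda>"
  define t where "t = transpose \<Lambda> *v b"
  define g where "g = ?W *v (\<Lambda> *v (D *v t))"
  have a: "a = b - g" by (simp add: a_def g_def t_def)
  have g: "subvec R g = g" by (simp add: g_def subvec_sub_inv)
  then show "subvec R (b - a) = b - a" by (simp add: a)
  \<comment> \<open>The form of the block inverse at w equals the form of \<open>U\<close> at W w,
    because U W w agrees with w on the support of W w.\<close>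
  have W_psd: "0 \<le> w \<bullet> (?W *v w)" for w
  proof -
    have "w \<bullet> (?W *v w) = (?W *v w) \<bullet> (U *v (?W *v w))"
      by (metis inner_commute inner_subvec subvec_sub_inv sub_inv_right_vec[OF ns])
    then show ?thesis using psd by simp
  qed
  have "invertible ?C"
  proof (rule invertible_if_trivial_kernel)
    fix v assume 0: "?C *v v = 0"
    \<comment> \<open>The identity summand makes the form of \<open>?C\<close> at least the squared
      norm of v, so the kernel is trivial whatever the rank of \<Lambda>.\<close>
    have "v \<bullet> (?C *v v) = v \<bullet> v + (\<Lambda> *v v) \<bullet> (?W *v (\<Lambda> *v v))"
      by (simp add: matrix_vector_mult_add_rdistrib inner_add_right matrix_vector_mul_assoc[symmetric]
          matrix_vector_inner_transpose)
    then have "v \<bullet> v \<le> 0" using 0 W_psd[of "\<Lambda> *v v"] by simp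
    then show "v = 0" by (metis inner_ge_zero inner_eq_zero_iff order_antisym)
  qed
  then have "?C *v (D *v t) = t"
    unfolding D_def by (simp only: matrix_vector_mul_assoc matrix_inv_invertible matrix_vector_mul_lid)
  \<comment> \<open>By definition \<Lambda>' g is (C - I) D t, and C D t = t.\<close>
  then have Dt: "transpose \<Lambda> *v g = t - D *v t"
    by (simp add: g_def matrix_vector_mult_add_rdistrib matrix_vector_mul_assoc[symmetric] algebra_simps)
  have Sa: "(\<Lambda> ** transpose \<Lambda> + U) *v a = \<Lambda> *v (D *v t) + U *v b - U *v g"
    by (simp add: a matrix_vector_mult_add_rdistrib matrix_vector_mult_diff_distrib
        matrix_vector_mul_assoc[symmetric] Dt t_def[symmetric] del: transpose_matrix_vector)
  have Ub: "subvec R (U *v b) = 0"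
  proof -
    have "(U *v b) $ i = 0" if "i \<in> R" for i
    proof -
      have "U $ i $ j * b $ j = 0" for j
        using block that arg_cong[OF b, of "\<lambda>v. v $ j"] by (cases "j \<in> R") auto
      then show ?thesis
        unfolding matrix_vector_mult_def vec_lambda_beta by (intro sum.neutral) simp
    qed
    then show ?thesis by (simp add: vec_eq_iff)
  qed
  have Ug: "subvec (- R) (U *v g) = 0"
  proof -
    have "(U *v g) $ i = 0" if "i \<notin> R" for i
    proof -
      have "U $ i $ j * g $ j = 0" for j
        using block that arg_cong[OF g, of "\<lambda>v. v $ j"] by (cases "j \<in> R") auto
      then show ?thesis
        unfolding matrix_vector_mult_def vec_lambda_beta by (intro sum.neutral) simp
    qed
    then show ?thesis by (simp add: vec_eq_iff)
  qed
  have "subvec R (U *v g) = subvec R (\<Lambda> *v (D *v t))"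
    unfolding g_def by (rule sub_inv_right_vec[OF ns])
  then show 0: "subvec R ((\<Lambda> ** transpose \<Lambda> + U) *v a) = 0"
    unfolding Sa using Ub by (simp add: subvec_add subvec_diff)
  have "b \<bullet> (U *v g) = 0"
    using subvec_inner_eq_0[OF Ug, of b] subvec_inner_eq_0[of R b "U *v g"] b
      subvec_compl_split[of R b] by simp
  moreover have "g \<bullet> ((\<Lambda> ** transpose \<Lambda> + U) *v a) = 0"
    using subvec_inner_eq_0[OF 0, of g] g by simp
  ultimately have "a \<bullet> ((\<Lambda> ** transpose \<Lambda> + U) *v a) = b \<bullet> (\<Lambda> *v (D *v t) + U *v b)"
    unfolding a inner_diff_left by (simp add: Sa[unfolded a] inner_diff_right)
  then show "a \<bullet> ((\<Lambda> ** transpose \<Lambda> + U) *v a) = b \<bullet> ((\<Lambda> ** D ** transpose \<Lambda> + U) *v b)"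
    by (simp add: t_def matrix_vector_mult_add_rdistrib matrix_vector_mul_assoc[symmetric])
qed

context prob_space
begin

section \<open>Projection residuals of normal vectors, and the covariance of the factor
  model\<close>

lemma normal_expectation_square:
  fixes x :: "'a \<Rightarrow> real^'p"
  assumes N: "multivariate_normal M x 0 (cov_mat M x)"
  shows "integrable M (\<lambda>\<omega>. (a \<bullet> x \<omega>)\<^sup>2)" and "integrable M (\<lambda>\<omega>. a \<bullet> x \<omega>)"
    and "expectation (\<lambda>\<omega>. a \<bullet> x \<omega>) = 0"
    and "expectation (\<lambda>\<omega>. (a \<bullet> x \<omega>)\<^sup>2) = a \<bullet> (cov_mat M x *v a)"
proof -
  have x [measurable]: "x \<in> borel_measurable M" using N by (simp add: multivariate_normal_def)
  note mom = multivariate_normal_moments[OF N]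
  show sq: "integrable M (\<lambda>\<omega>. (a \<bullet> x \<omega>)\<^sup>2)"
    by (rule integrable_square_inner[OF x mom(1)])
  show "integrable M (\<lambda>\<omega>. a \<bullet> x \<omega>)"
    by (rule square_integrable_imp_integrable[OF _ sq]) measurable
  have "integrable M (\<lambda>\<omega>. x \<omega> $ i)" for i
    by (rule square_integrable_imp_integrable[OF _ mom(1)]) measurable
  then show 0: "expectation (\<lambda>\<omega>. a \<bullet> x \<omega>) = 0"
    by (simp add: inner_vec_def mom(2))
  show "expectation (\<lambda>\<omega>. (a \<bullet> x \<omega>)\<^sup>2) = a \<bullet> (cov_mat M x *v a)"
    using cov_inner_inner[OF x mom(1), of a a] by (simp add: cov_def 0 power2_eq_square)
qed

lemma cond_var_normal:
  fixes x :: "'a \<Rightarrow> real^'p"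
  assumes N: "multivariate_normal M x 0 (cov_mat M x)"
    and a: "subvec S (cov_mat M x *v a) = 0" and ba: "subvec S (b - a) = b - a"
  shows "AE \<omega> in M. cond_var M (gen_alg M (\<lambda>\<omega>. subvec S (x \<omega>))) (\<lambda>\<omega>. b \<bullet> x \<omega>) \<omega>
    = a \<bullet> (cov_mat M x *v a)"
proof -
  have x [measurable]: "x \<in> borel_measurable M" using N by (simp add: multivariate_normal_def)
  note sq = normal_expectation_square[OF N]
  have proj: "(b - a) \<bullet> subvec S v = (b - a) \<bullet> v" for v by (simp add: inner_subvec ba)
  have "AE \<omega> in M. cond_var M (gen_alg M (\<lambda>\<omega>. subvec S (x \<omega>)))
      (\<lambda>\<omega>. (b - a) \<bullet> subvec S (x \<omega>) + a \<bullet> x \<omega>) \<omega> = a \<bullet> (cov_mat M x *v a)"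
  proof (rule cond_var_eq_const)
    show "integrable M (\<lambda>\<omega>. (b - a) \<bullet> subvec S (x \<omega>))" unfolding proj by (rule sq)
    fix h :: "real^'p \<Rightarrow> real"
    assume h: "h \<in> borel_measurable borel" "\<And>z. \<bar>h z\<bar> \<le> 1"
    show "expectation (\<lambda>\<omega>. h (subvec S (x \<omega>)) * (a \<bullet> x \<omega>)) = 0"
      using multivariate_normal_integral_mult[OF N a h, of "\<lambda>t. t"] sq by simp
    show "expectation (\<lambda>\<omega>. h (subvec S (x \<omega>)) * (a \<bullet> x \<omega>)\<^sup>2)
        = a \<bullet> (cov_mat M x *v a) * expectation (\<lambda>\<omega>. h (subvec S (x \<omega>)))"
      using multivariate_normal_integral_mult[OF N a h, of "\<lambda>t. t\<^sup>2"] sq[of a] by simp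
  qed (use sq in measurable)
  moreover have "(b - a) \<bullet> subvec S v + a \<bullet> v = b \<bullet> v" for v
    unfolding proj by (simp add: inner_diff_left)
  ultimately show ?thesis by simp
qed

text \<open>The coefficient used is \<beta> - a, which leaves the error a . x + \<epsilon>. After
  expanding its square, normality handles the terms in a . x alone, and the conditional moments
  handle those with \<epsilon>. Conditioning on all of \<open>x\<close> matters for the cross term,
  since a . x need not be a function of the covariates in \<open>S\<close>.\<close>

lemma expected_rss_normal:
  fixes x :: "'a \<Rightarrow> real^'p" and \<epsilon> :: "'a \<Rightarrow> real" and S :: "'p set"
    and xs :: "'n::finite \<Rightarrow> 'a \<Rightarrow> real^'p" and ys :: "'n \<Rightarrow> 'a \<Rightarrow> real"
  assumes N: "multivariate_normal M x 0 (cov_mat M x)" and inv: "invertible (cov_mat M x)"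
    and e [measurable]: "\<epsilon> \<in> borel_measurable M" and e2: "integrable M (\<lambda>\<omega>. (\<epsilon> \<omega>)\<^sup>2)"
    and ce1: "AE \<omega> in M. real_cond_exp M (gen_alg M x) \<epsilon> \<omega> = 0"
    and ce2: "AE \<omega> in M. real_cond_exp M (gen_alg M x) (\<lambda>\<omega>. (\<epsilon> \<omega>)\<^sup>2) \<omega> = s"
    and indep: "indep_vars (\<lambda>_. borel) (\<lambda>i \<omega>. (xs i \<omega>, ys i \<omega>)) UNIV"
    and ident: "\<And>i. distr M borel (\<lambda>\<omega>. (xs i \<omega>, ys i \<omega>))
      = distr M borel (\<lambda>\<omega>. (x \<omega>, \<beta> \<bullet> x \<omega> + \<epsilon> \<omega>))"
    and a: "subvec S (cov_mat M x *v a) = 0" and ba: "subvec S (\<beta> - a) = \<beta> - a"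
    and card: "CARD('p) \<le> CARD('n)"
  shows "expectation (\<lambda>\<omega>. (norm ((\<chi> i. ys i \<omega>) - ls_fit S (\<chi> i. xs i \<omega>) (\<chi> i. ys i \<omega>)))\<^sup>2)
    = (a \<bullet> (cov_mat M x *v a) + s) * (real CARD('n) - real (card S))"
proof -
  have x [measurable]: "x \<in> borel_measurable M" using N by (simp add: multivariate_normal_def)
  note sq = normal_expectation_square[OF N]
  have w: "\<beta> \<bullet> v + \<epsilon> \<omega> - v \<bullet> (\<beta> - a) = a \<bullet> v + \<epsilon> \<omega>" for v \<omega>
    by (simp add: inner_diff_right inner_commute)
  have e1: "integrable M \<epsilon>" by (rule square_integrable_imp_integrable[OF e e2])
  have ae: "integrable M (\<lambda>\<omega>. (a \<bullet> x \<omega>) * \<epsilon> \<omega>)"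
    by (rule integrable_mult_square_integrable[OF _ _ sq(1) e2]) measurable
  show ?thesis
  proof (rule expected_rss_iid[OF x _ indep ident ba _ _ _ multivariate_normal_kernel(3)[OF N inv] card])
    show "integrable M (\<lambda>\<omega>. (\<beta> \<bullet> x \<omega> + \<epsilon> \<omega> - x \<omega> \<bullet> (\<beta> - a))\<^sup>2)"
      unfolding w by (rule integrable_square_add[OF _ e sq(1) e2]) measurable
    fix h :: "real^'p \<Rightarrow> real"
    assume h [measurable]: "h \<in> borel_measurable borel" and hb: "\<And>z. \<bar>h z\<bar> \<le> 1"
    have h_int: "integrable M (\<lambda>\<omega>. h (subvec S (x \<omega>)) * G \<omega>)"
      if "integrable M G" for G :: "'a \<Rightarrow> real"
    proof (rule Bochner_Integration.integrable_bound[OF that])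
      show "(\<lambda>\<omega>. h (subvec S (x \<omega>)) * G \<omega>) \<in> borel_measurable M"
        using borel_measurable_integrable[OF that] by measurable
      show "AE \<omega> in M. norm (h (subvec S (x \<omega>)) * G \<omega>) \<le> norm (G \<omega>)"
        using hb by (intro AE_I2) (simp add: abs_mult mult_left_le_one_le)
    qed
    note i = h_int[OF sq(2)[of a]] h_int[OF e1] h_int[OF sq(1)[of a]] h_int[OF e2] h_int[OF ae]
    have 1: "expectation (\<lambda>\<omega>. h (subvec S (x \<omega>)) * \<epsilon> \<omega>) = 0"
      using integral_mult_const_cond_exp[where g = "\<lambda>v. h (subvec S v)", OF x e _ i(2) ce1] by simp
    have 2: "expectation (\<lambda>\<omega>. h (subvec S (x \<omega>)) * (\<epsilon> \<omega>)\<^sup>2)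
        = s * expectation (\<lambda>\<omega>. h (subvec S (x \<omega>)))"
      using integral_mult_const_cond_exp[where g = "\<lambda>v. h (subvec S v)", OF x _ _ i(4) ce2] by simp
    have 3: "expectation (\<lambda>\<omega>. h (subvec S (x \<omega>)) * (a \<bullet> x \<omega> * \<epsilon> \<omega>)) = 0"
      using integral_mult_const_cond_exp[where g = "\<lambda>v. h (subvec S v) * (a \<bullet> v)", OF x e _ _ ce1] i(5)
      by (simp add: mult.assoc)
    have 4: "expectation (\<lambda>\<omega>. h (subvec S (x \<omega>)) * (a \<bullet> x \<omega>)) = 0"
      using multivariate_normal_integral_mult[OF N a h hb, of "\<lambda>t. t"] sq by simp
    have 5: "expectation (\<lambda>\<omega>. h (subvec S (x \<omega>)) * (a \<bullet> x \<omega>)\<^sup>2)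
        = a \<bullet> (cov_mat M x *v a) * expectation (\<lambda>\<omega>. h (subvec S (x \<omega>)))"
      using multivariate_normal_integral_mult[OF N a h hb, of "\<lambda>t. t\<^sup>2"] sq[of a] by simp
    show "expectation (\<lambda>\<omega>. h (subvec S (x \<omega>)) * (\<beta> \<bullet> x \<omega> + \<epsilon> \<omega> - x \<omega> \<bullet> (\<beta> - a))) = 0"
      unfolding w using i 1 4 by (simp add: distrib_left)
    have "h (subvec S (x \<omega>)) * (a \<bullet> x \<omega> + \<epsilon> \<omega>)\<^sup>2 = h (subvec S (x \<omega>)) * (a \<bullet> x \<omega>)\<^sup>2
        + 2 * (h (subvec S (x \<omega>)) * (a \<bullet> x \<omega> * \<epsilon> \<omega>)) + h (subvec S (x \<omega>)) * (\<epsilon> \<omega>)\<^sup>2" for \<omega>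
      by (simp add: power2_sum algebra_simps)
    then show "expectation (\<lambda>\<omega>. h (subvec S (x \<omega>)) * (\<beta> \<bullet> x \<omega> + \<epsilon> \<omega> - x \<omega> \<bullet> (\<beta> - a))\<^sup>2)
        = (a \<bullet> (cov_mat M x *v a) + s) * expectation (\<lambda>\<omega>. h (subvec S (x \<omega>)))"
      unfolding w using i 2 3 5 by (simp add: distrib_right)
  qed measurable
qed

lemma cov_mat_factor_model:
  fixes x u :: "'a \<Rightarrow> real^'p" and f :: "'a \<Rightarrow> real^'k" and \<Lambda> :: "real^'k^'p"
  assumes x [measurable]: "x \<in> borel_measurable M" and f [measurable]: "f \<in> borel_measurable M"
    and u [measurable]: "u \<in> borel_measurable M"
    and x2: "\<And>i. integrable M (\<lambda>\<omega>. (x \<omega> $ i)\<^sup>2)" and f2: "\<And>k. integrable M (\<lambda>\<omega>. (f \<omega> $ k)\<^sup>2)"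
    and model: "AE \<omega> in M. x \<omega> = \<Lambda> *v f \<omega> + u \<omega>"
    and var_f: "cov_mat M f = mat 1"
    and fu: "\<And>k j. cov M (\<lambda>\<omega>. f \<omega> $ k) (\<lambda>\<omega>. u \<omega> $ j) = 0"
  shows "cov_mat M x = \<Lambda> ** transpose \<Lambda> + cov_mat M u"
    and "integrable M (\<lambda>\<omega>. (u \<omega> $ j)\<^sup>2)"
proof -
  have F2: "integrable M (\<lambda>\<omega>. (b \<bullet> f \<omega>)\<^sup>2)" for b by (rule integrable_square_inner[OF f f2])
  have comp: "AE \<omega> in M. x \<omega> $ i = \<Lambda> $ i \<bullet> f \<omega> + u \<omega> $ i" for i
    using model by eventually_elim (simp add: matrix_vector_mul_component)
  show u2: "integrable M (\<lambda>\<omega>. (u \<omega> $ j)\<^sup>2)" for j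
  proof -
    have "integrable M (\<lambda>\<omega>. (x \<omega> $ j + (- \<Lambda> $ j) \<bullet> f \<omega>)\<^sup>2)"
      by (rule integrable_square_add[OF _ _ x2 F2]) measurable
    moreover have "AE \<omega> in M. (x \<omega> $ j + (- \<Lambda> $ j) \<bullet> f \<omega>)\<^sup>2 = (u \<omega> $ j)\<^sup>2"
      using comp[of j] by eventually_elim (simp add: inner_minus_left)
    ultimately show ?thesis
      by (subst (asm) integrable_cong_AE) (simp_all, measurable)
  qed
  have fu0: "cov M (\<lambda>\<omega>. b \<bullet> f \<omega>) (\<lambda>\<omega>. u \<omega> $ j) = 0" for b j
    using cov_inner_left[where a = b, OF f _ f2 u2, of j] by (simp add: fu)
  have one: "cov M (\<lambda>\<omega>. x \<omega> $ i) Y = cov M (\<lambda>\<omega>. \<Lambda> $ i \<bullet> f \<omega>) Y + cov M (\<lambda>\<omega>. u \<omega> $ i) Y"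
    if Y: "Y \<in> borel_measurable M" "integrable M (\<lambda>\<omega>. (Y \<omega>)\<^sup>2)" for i Y
    using cov_add_left[OF _ _ Y(1) F2[of "\<Lambda> $ i"] u2[of i] Y(2)]
      cov_cong_AE[OF _ _ Y(1) comp[of i]] by simp
  have "cov M (\<lambda>\<omega>. x \<omega> $ i) (\<lambda>\<omega>. x \<omega> $ j) = \<Lambda> $ i \<bullet> \<Lambda> $ j + cov M (\<lambda>\<omega>. u \<omega> $ i) (\<lambda>\<omega>. u \<omega> $ j)"
    for i j
  proof -
    have "cov M (\<lambda>\<omega>. x \<omega> $ i) (\<lambda>\<omega>. x \<omega> $ j)
        = cov M (\<lambda>\<omega>. x \<omega> $ j) (\<lambda>\<omega>. \<Lambda> $ i \<bullet> f \<omega>) + cov M (\<lambda>\<omega>. x \<omega> $ j) (\<lambda>\<omega>. u \<omega> $ i)"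
      using one[of "\<lambda>\<omega>. x \<omega> $ j" i] x2
      by (simp add: cov_commute[of "\<lambda>\<omega>. x \<omega> $ j"])
    also have "cov M (\<lambda>\<omega>. x \<omega> $ j) (\<lambda>\<omega>. \<Lambda> $ i \<bullet> f \<omega>) = \<Lambda> $ i \<bullet> \<Lambda> $ j"
      using one[of "\<lambda>\<omega>. \<Lambda> $ i \<bullet> f \<omega>" j] F2 fu0[of "\<Lambda> $ i" j] cov_inner_inner[OF f f2]
      by (simp add: var_f cov_commute[of "\<lambda>\<omega>. u \<omega> $ j"] inner_commute[of "\<Lambda> $ j" "\<Lambda> $ i"])
    also have "cov M (\<lambda>\<omega>. x \<omega> $ j) (\<lambda>\<omega>. u \<omega> $ i) = cov M (\<lambda>\<omega>. u \<omega> $ j) (\<lambda>\<omega>. u \<omega> $ i)"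
      using one[of "\<lambda>\<omega>. u \<omega> $ i" j] u2 fu0 by simp
    also have "\<dots> = cov M (\<lambda>\<omega>. u \<omega> $ i) (\<lambda>\<omega>. u \<omega> $ j)" by (rule cov_commute)
    finally show ?thesis .
  qed
  then show "cov_mat M x = \<Lambda> ** transpose \<Lambda> + cov_mat M u"
    by (simp add: vec_eq_iff cov_mat_def matrix_matrix_mult_def transpose_def inner_vec_def)
qed

end

text \<open>The conditional variance is a random variable, so each identity holds almost everywhere.
  The premises of (a) and (b) fix the conditional mean and variance of \<epsilon> given
  \<open>x\<close>, because the projection I - H is a nonlinear function of the design. In (c) the
  covariance between the idiosyncratic parts of the two blocks is set to 0, as it would otherwise
  enter the covariance between the blocks of \<open>x\<close>.\<close>

theorem proposition1:
  fixes P :: "'a measure"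
    and M m :: nat
    and blk :: "'p::finite \<Rightarrow> nat"
    and x :: "'a \<Rightarrow> real^'p"
    and \<beta> :: "real^'p"
    and \<epsilon> y :: "'a \<Rightarrow> real"
    and \<sigma>\<^sub>\<epsilon> :: real
    and xs :: "'n::finite \<Rightarrow> 'a \<Rightarrow> real^'p"
    and ys :: "'n \<Rightarrow> 'a \<Rightarrow> real"
    and \<Lambda> :: "real^'k::finite^'p"
    and f :: "'a \<Rightarrow> real^'k"
    and u :: "'a \<Rightarrow> real^'p"
  defines "B \<equiv> \<lambda>l. {j. blk j = l}"
    and "R \<equiv> {j. blk j \<noteq> m}"
    and "X \<equiv> \<lambda>\<omega>. (\<chi> i. xs i \<omega>) :: real^'p^'n"
    and "Y \<equiv> \<lambda>\<omega>. (\<chi> i. ys i \<omega>) :: real^'n"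
  defines "cvar \<equiv> cond_var P (gen_alg P (\<lambda>\<omega>. subvec R (x \<omega>)))
                  (\<lambda>\<omega>. subvec (B m) (x \<omega>) \<bullet> subvec (B m) \<beta>)"
    and "rss \<equiv> integral\<^sup>L P (\<lambda>\<omega>. (norm (Y \<omega> - ls_fit UNIV (X \<omega>) (Y \<omega>)))\<^sup>2)"
    and "rss_m \<equiv> integral\<^sup>L P (\<lambda>\<omega>. (norm (Y \<omega> - ls_fit R (X \<omega>) (Y \<omega>)))\<^sup>2)"
    and "\<sigma>y2 \<equiv> cov P y y"
  defines "r2 \<equiv> 1 - rss / ((real CARD('n) - real CARD('p)) * \<sigma>y2)"
    and "r2_m \<equiv> 1 - rss_m / ((real CARD('n) - real (card R)) * \<sigma>y2)"
  assumes P: "prob_space P"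
    and blocks: "range blk \<subseteq> {1..M}" and m: "m \<in> {1..M}"
    and normal: "multivariate_normal P x 0 (cov_mat P x)"
    and nonsingular: "invertible (cov_mat P x)"
    and eps_L2: "\<epsilon> \<in> borel_measurable P" "integrable P (\<lambda>\<omega>. (\<epsilon> \<omega>)\<^sup>2)"
    and eps_mean: "integral\<^sup>L P \<epsilon> = 0" and eps_var: "cov P \<epsilon> \<epsilon> = \<sigma>\<^sub>\<epsilon>\<^sup>2"
    and eps_uncorr: "\<forall>j. cov P \<epsilon> (\<lambda>\<omega>. x \<omega> $ j) = 0"
    and y: "y = (\<lambda>\<omega>. (\<Sum>l=1..M. subvec (B l) (x \<omega>) \<bullet> subvec (B l) \<beta>) + \<epsilon> \<omega>)"
    and indep: "prob_space.indep_vars P (\<lambda>_. borel) (\<lambda>i \<omega>. (xs i \<omega>, ys i \<omega>)) UNIV"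
    and ident: "\<forall>i. distr P borel (\<lambda>\<omega>. (xs i \<omega>, ys i \<omega>)) = distr P borel (\<lambda>\<omega>. (x \<omega>, y \<omega>))"
    and n: "CARD('p) < CARD('n)"
  shows
    "((AE \<omega> in P. real_cond_exp P (gen_alg P x) \<epsilon> \<omega> = 0) \<and>
      (AE \<omega> in P. real_cond_exp P (gen_alg P x) (\<lambda>\<omega>. (\<epsilon> \<omega>)\<^sup>2) \<omega> = \<sigma>\<^sub>\<epsilon>\<^sup>2)
      \<longrightarrow>
        (AE \<omega> in P. cvar \<omega> = rss_m / (real CARD('n) - real (card R)) - \<sigma>\<^sub>\<epsilon>\<^sup>2) \<and>
        (AE \<omega> in P. cvar \<omega> = \<sigma>y2 * (r2 - r2_m)))
     \<and>
     (f \<in> borel_measurable P \<and> u \<in> borel_measurable P \<and>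
      (\<forall>k. integrable P (\<lambda>\<omega>. (f \<omega> $ k)\<^sup>2)) \<and>
      (AE \<omega> in P. x \<omega> = \<Lambda> *v f \<omega> + u \<omega>) \<and>
      cov_mat P f = mat 1 \<and>
      (\<forall>k j. cov P (\<lambda>\<omega>. f \<omega> $ k) (\<lambda>\<omega>. u \<omega> $ j) = 0) \<and>
      (\<forall>i\<in>B m. \<forall>j\<in>R. cov P (\<lambda>\<omega>. u \<omega> $ i) (\<lambda>\<omega>. u \<omega> $ j) = 0) \<and>
      nonsing_on R (cov_mat P u)
      \<longrightarrow>
        (AE \<omega> in P. cvar \<omega> =
           subvec (B m) \<beta> \<bullet>
             ((\<Lambda> ** matrix_inv (mat 1 + transpose \<Lambda> ** sub_inv R (cov_mat P u) ** \<Lambda>) ** transpose \<Lambda>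
               + cov_mat P u) *v subvec (B m) \<beta>)))"
proof -
  interpret prob_space P by (rule P)
  let ?\<Sigma> = "cov_mat P x"
  let ?b = "subvec (B m) \<beta>"
  have x [measurable]: "x \<in> borel_measurable P" using normal by (simp add: multivariate_normal_def)
  note mom = multivariate_normal_moments[OF normal]
  have BR: "B m = - R" unfolding B_def R_def by auto
  have Z: "subvec (B m) v \<bullet> subvec (B m) \<beta> = ?b \<bullet> v" for v
    by (metis inner_commute inner_subvec subvec_subvec)
  have cvar_eq: "AE \<omega> in P. cvar \<omega> = a \<bullet> (?\<Sigma> *v a)"
    if "subvec R (?\<Sigma> *v a) = 0" "subvec R (?b - a) = ?b - a" for a
    using cond_var_normal[OF normal that] by (simp add: cvar_def Z)
  have y_eq: "y = (\<lambda>\<omega>. \<beta> \<bullet> x \<omega> + \<epsilon> \<omega>)"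
  proof
    fix \<omega>
    have fin: "(\<Sum>l=1..M. if blk j = l then t else 0) = t" for j and t :: real
    proof -
      have "blk j \<in> {1..M}" using blocks by blast
      then show ?thesis by (simp add: sum.delta)
    qed
    have "(\<Sum>l=1..M. subvec (B l) (x \<omega>) \<bullet> subvec (B l) \<beta>)
        = (\<Sum>l=1..M. \<Sum>j\<in>UNIV. if blk j = l then x \<omega> $ j * \<beta> $ j else 0)"
      by (intro sum.cong refl) (auto simp: inner_vec_def B_def intro!: sum.cong)
    also have "\<dots> = (\<Sum>j\<in>UNIV. \<Sum>l=1..M. if blk j = l then x \<omega> $ j * \<beta> $ j else 0)"
      by (rule sum.swap)
    also have "\<dots> = \<beta> \<bullet> x \<omega>" by (simp only: fin) (simp add: inner_vec_def mult.commute)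
    finally show "y \<omega> = \<beta> \<bullet> x \<omega> + \<epsilon> \<omega>" by (simp add: y)
  qed
  note kernel = multivariate_normal_kernel[OF normal nonsingular]
  show ?thesis
  proof (intro conjI impI; elim conjE)
    assume ce1: "AE \<omega> in P. real_cond_exp P (gen_alg P x) \<epsilon> \<omega> = 0"
      and ce2: "AE \<omega> in P. real_cond_exp P (gen_alg P x) (\<lambda>\<omega>. (\<epsilon> \<omega>)\<^sup>2) \<omega> = \<sigma>\<^sub>\<epsilon>\<^sup>2"
    \<comment> \<open>The subtracted vector is the population regression coefficient of b . x on the
      covariates in \<open>R\<close>.\<close>
    define a where "a = ?b - sub_inv R ?\<Sigma> *v (?\<Sigma> *v ?b)"
    define s where "s = a \<bullet> (?\<Sigma> *v a)"
    have a: "subvec R (?\<Sigma> *v a) = 0"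
      using sub_inv_right_vec[OF kernel(1)[of R], of "?\<Sigma> *v ?b"]
      unfolding a_def matrix_vector_mult_diff_distrib by (simp add: subvec_diff)
    have ba: "subvec R (?b - a) = ?b - a" by (simp add: a_def subvec_sub_inv)
    \<comment> \<open>Since \<beta> and its block \<open>m\<close> differ only on \<open>R\<close>,
      the same \<open>a\<close> is the residual direction for y and for the contribution of block
      \<open>m\<close>.\<close>
    have split: "\<beta> - a = subvec R \<beta> + (?b - a)"
      using subvec_compl_split[of R \<beta>] by (simp add: BR algebra_simps)
    have ba': "subvec R (\<beta> - a) = \<beta> - a"
      unfolding split by (simp only: subvec_add ba subvec_subvec)
    have cvar_s: "AE \<omega> in P. cvar \<omega> = s" using cvar_eq[OF a ba] by (simp add: s_def)
    note rss_normal = expected_rss_normal[OF normal nonsingular eps_L2 ce1 ce2 indep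
        ident[rule_format, unfolded y_eq]]
    have rss_m: "rss_m = (s + \<sigma>\<^sub>\<epsilon>\<^sup>2) * (real CARD('n) - real (card R))"
      using rss_normal[OF a ba'] n by (simp add: rss_m_def X_def Y_def s_def)
    \<comment> \<open>Regression on all covariates leaves no projection residual:
      \<open>S = UNIV\<close> with \<open>a = 0\<close>.\<close>
    have rss: "rss = \<sigma>\<^sub>\<epsilon>\<^sup>2 * (real CARD('n) - real CARD('p))"
      using rss_normal[of UNIV 0] n by (simp add: rss_def X_def Y_def subvec_def vec_eq_iff)
    have "card R \<le> CARD('p)" by (rule card_mono) auto
    then have nR: "real CARD('n) - real (card R) \<noteq> 0" and np: "real CARD('n) - real CARD('p) \<noteq> 0"
      using n by auto
    show "AE \<omega> in P. cvar \<omega> = rss_m / (real CARD('n) - real (card R)) - \<sigma>\<^sub>\<epsilon>\<^sup>2"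
      using cvar_s nR by (simp add: rss_m)
    have var_y: "\<sigma>y2 = \<beta> \<bullet> (?\<Sigma> *v \<beta>) + \<sigma>\<^sub>\<epsilon>\<^sup>2"
    proof -
      let ?z = "\<lambda>\<omega>. \<beta> \<bullet> x \<omega>"
      have z [measurable]: "?z \<in> borel_measurable P" by measurable
      note z2 = normal_expectation_square(1)[OF normal, of \<beta>]
      have e [measurable]: "\<epsilon> \<in> borel_measurable P" by (rule eps_L2)
      have ym [measurable]: "y \<in> borel_measurable P" unfolding y_eq by measurable
      have y2: "integrable P (\<lambda>\<omega>. (y \<omega>)\<^sup>2)"
        unfolding y_eq by (rule integrable_square_add[OF z e z2 eps_L2(2)])
      have add: "cov P y W = cov P ?z W + cov P \<epsilon> W"
        if "W \<in> borel_measurable P" "integrable P (\<lambda>\<omega>. (W \<omega>)\<^sup>2)" for W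
        unfolding y_eq using cov_add_left[OF z e that(1) z2 eps_L2(2) that(2)] .
      have ez: "cov P ?z \<epsilon> = 0"
        using cov_inner_left[where a = \<beta>, OF x e mom(1) eps_L2(2)] eps_uncorr
        by (simp add: cov_commute[of _ \<epsilon>])
      have "\<sigma>y2 = cov P ?z y + cov P \<epsilon> y"
        unfolding \<sigma>y2_def by (rule add[OF ym y2])
      also have "cov P ?z y = \<beta> \<bullet> (?\<Sigma> *v \<beta>)"
        using add[OF z z2] ez cov_inner_inner[OF x mom(1), of \<beta> \<beta>]
        by (simp add: cov_commute[of ?z y] cov_commute[of \<epsilon> ?z])
      also have "cov P \<epsilon> y = \<sigma>\<^sub>\<epsilon>\<^sup>2"
        using add[OF e eps_L2(2)] ez eps_var by (simp add: cov_commute[of \<epsilon> y])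
      finally show ?thesis .
    qed
    have "\<sigma>y2 * (r2 - r2_m) = s"
    \<comment> \<open>When y has variance 0 the left side is 0, whatever the quotients by 0 are.
      Positive definiteness of the covariance matrix then forces \<beta> = 0, so the conditional
      variance vanishes as well.\<close>
    proof (cases "\<sigma>y2 = 0")
      case True
      then have "\<beta> = 0"
        using var_y kernel(2)[of \<beta>] zero_le_power2[of \<sigma>\<^sub>\<epsilon>] by fastforce
      then have "?b = 0" by (simp add: vec_eq_iff)
      then show ?thesis using True by (simp add: s_def a_def)
    next
      case False
      have cancel: "t * d / (d * \<sigma>y2) = t / \<sigma>y2" if "d \<noteq> 0" for t d
        using that by simp
      have "r2 - r2_m = (s + \<sigma>\<^sub>\<epsilon>\<^sup>2) / \<sigma>y2 - \<sigma>\<^sub>\<epsilon>\<^sup>2 / \<sigma>y2"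
        unfolding r2_def r2_m_def rss rss_m
        by (simp only: cancel[OF nR] cancel[OF np])
      then show ?thesis using False by (simp add: diff_divide_distrib[symmetric])
    qed
    then show "AE \<omega> in P. cvar \<omega> = \<sigma>y2 * (r2 - r2_m)" using cvar_s by simp
  next
    assume f: "f \<in> borel_measurable P" and u: "u \<in> borel_measurable P"
      and f2: "\<forall>k. integrable P (\<lambda>\<omega>. (f \<omega> $ k)\<^sup>2)"
      and model: "AE \<omega> in P. x \<omega> = \<Lambda> *v f \<omega> + u \<omega>"
      and var_f: "cov_mat P f = mat 1"
      and fu: "\<forall>k j. cov P (\<lambda>\<omega>. f \<omega> $ k) (\<lambda>\<omega>. u \<omega> $ j) = 0"
      and uu: "\<forall>i\<in>B m. \<forall>j\<in>R. cov P (\<lambda>\<omega>. u \<omega> $ i) (\<lambda>\<omega>. u \<omega> $ j) = 0"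
      and ns: "nonsing_on R (cov_mat P u)"
    note factor = cov_mat_factor_model[OF x f u mom(1) f2[rule_format] model var_f fu[rule_format]]
    have psd: "0 \<le> v \<bullet> (cov_mat P u *v v)" for v
      using cov_inner_inner[OF u factor(2), of v v] cov_self_nonneg[of "\<lambda>\<omega>. v \<bullet> u \<omega>"] by simp
    have b: "subvec R ?b = 0" by (simp add: vec_eq_iff BR)
    have block: "\<forall>i\<in>- R. \<forall>j\<in>R. cov_mat P u $ i $ j = 0 \<and> cov_mat P u $ j $ i = 0"
      using uu unfolding BR cov_mat_def by (auto intro: trans[OF cov_commute])
    \<comment> \<open>Folding the factor decomposition turns \<Lambda> \<Lambda>' + U into the
      covariance matrix of \<open>x\<close>, so the explicit vector qualifies as a projection
      residual in \<open>cvar_eq\<close>.\<close>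
    note proj = factor_model_projection[OF psd ns b block, of \<Lambda>, folded factor(1)]
    show "AE \<omega> in P. cvar \<omega> = ?b \<bullet> ((\<Lambda> ** matrix_inv (mat 1 + transpose \<Lambda>
        ** sub_inv R (cov_mat P u) ** \<Lambda>) ** transpose \<Lambda> + cov_mat P u) *v ?b)"
      using cvar_eq[OF proj(1,3)] unfolding proj(2) .
  qed
qed

end
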